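(* Let $\mathcal{A}$ be an abelian category and let $(\mathcal{C}, \mathcal{D})$, $(\mathcal{C}', \mathcal{D}')$ be torsion pairs in $\mathcal{A}$ such that $\mathcal{C}\subseteq \mathcal{C}'$. Then the intersection $\mathcal{C}' \cap \mathcal{D}$ (a full subcategory of $\mathcal{A}$) is a quasi-abelian category, and there is an inclusion preserving bijection $$\{(\mathcal{X}, \mathcal{Y}) \text{ torsion pair in } \mathcal{A} \mid \mathcal{C} \subseteq \mathcal{X} \subseteq \mathcal{C}'\} \longleftrightarrow \{ (\mathcal{T}, \mathcal{F}) \text{ torsion pair in }\mathcal{C}'\cap \mathcal{D} \}$$ given from left to right by $(\mathcal{X}, \mathcal{Y}) \mapsto (\mathcal{X} \cap \mathcal{D}, \mathcal{Y}\cap \mathcal{C}')$, with inverse given from right to left by $(\mathcal{T}, \mathcal{F}) \mapsto (\mathcal{C}\ast \mathcal{T}, \mathcal{F} \ast \mathcal{D}')$.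
   Context: An additive category is pre-abelian if every morphism has a kernel and a cokernel. It is quasi-abelian if it is pre-abelian and cokernels are stable under pullback and kernels are stable under pushout. A short exact sequence $0 \to X \xrightarrow{f} Y \xrightarrow{g} Z \to 0$ in a pre-abelian category is a composable pair with $f$ a kernel of $g$ and $g$ a cokernel of $f$. A torsion pair in a pre-abelian category $\mathcal{B}$ is an ordered pair $(\mathcal{T},\mathcal{F})$ of full subcategories (closed under isomorphism) such that (T1) $\mathrm{Hom}_{\mathcal{B}}(T,F)=0$ for all $T\in\mathcal{T}$, $F\in\mathcal{F}$; (T2) for every $M \in \mathcal{B}$ there is a short exact sequence $0 \to {}_{\mathcal{T}}M \to M \to M_{\mathcal{F}} \to 0$ in $\mathcal{B}$ with ${}_{\mathcal{T}}M\in\mathcal{T}$ and $M_{\mathcal{F}}\in\mathcal{F}$. Then $\mathcal{T}$ is called a torsion class and $\mathcal{F}$ a torsionfree class. For subcategories $\mathcal{U},\mathcal{V}$ of $\mathcal{A}$, $\mathcal{U}\ast\mathcal{V}$ is the full subcategory of objects $M$ for which there is a short exact sequence $0\to M'\to M\to M''\to 0$ in $\mathcal{A}$ with $M'\in\mathcal{U}$ and $M''\in\mathcal{V}$. Inclusion preserving refers to inclusion of torsion classes. *)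

theory Defs
  imports "HOL-Algebra.Group"
begin

record ('o, 'm) precat =
  Obj :: "'o set"
  Arr :: "'m set"
  Dom :: "'m \<Rightarrow> 'o"
  Cod :: "'m \<Rightarrow> 'o"
  Ide :: "'o \<Rightarrow> 'm"
  Comp :: "'m \<Rightarrow> 'm \<Rightarrow> 'm"  (infixr \<open>\<cdot>\<index>\<close> 70)
  Add :: "'m \<Rightarrow> 'm \<Rightarrow> 'm"
  Zero :: "'o \<Rightarrow> 'o \<Rightarrow> 'm"

text \<open>The operations are only meaningful on \<open>Obj\<close> and \<open>Arr\<close>; composition \<open>g \<cdot> f\<close>
  means \<open>f\<close> first, and \<open>Zero X Y\<close> is the zero morphism from \<open>X\<close> to \<open>Y\<close>.\<close>

definition Hom :: "('o, 'm) precat \<Rightarrow> 'o \<Rightarrow> 'o \<Rightarrow> 'm set" where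
  "Hom A X Y = {f \<in> Arr A. Dom A f = X \<and> Cod A f = Y}"

definition hom_group :: "('o, 'm) precat \<Rightarrow> 'o \<Rightarrow> 'o \<Rightarrow> 'm monoid" where
  "hom_group A X Y = \<lparr>carrier = Hom A X Y, mult = Add A, one = Zero A X Y\<rparr>"

locale category =
  fixes A :: "('o, 'm) precat" (structure)
  assumes Dom_closed: "f \<in> Arr A \<Longrightarrow> Dom A f \<in> Obj A"
    and Cod_closed: "f \<in> Arr A \<Longrightarrow> Cod A f \<in> Obj A"
    and Ide_closed: "X \<in> Obj A \<Longrightarrow> Ide A X \<in> Hom A X X"
    and Comp_closed: "\<lbrakk>f \<in> Hom A X Y; g \<in> Hom A Y Z\<rbrakk> \<Longrightarrow> g \<cdot> f \<in> Hom A X Z"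
    and Comp_Ide: "f \<in> Hom A X Y \<Longrightarrow> f \<cdot> Ide A X = f"
    and Ide_Comp: "f \<in> Hom A X Y \<Longrightarrow> Ide A Y \<cdot> f = f"
    and Comp_assoc:
      "\<lbrakk>f \<in> Hom A W X; g \<in> Hom A X Y; h \<in> Hom A Y Z\<rbrakk> \<Longrightarrow> (h \<cdot> g) \<cdot> f = h \<cdot> (g \<cdot> f)"

locale preadditive_category = category +
  assumes Hom_comm_group: "\<lbrakk>X \<in> Obj A; Y \<in> Obj A\<rbrakk> \<Longrightarrow> comm_group (hom_group A X Y)"
    and Comp_Add:
      "\<lbrakk>f \<in> Hom A X Y; f' \<in> Hom A X Y; g \<in> Hom A Y Z\<rbrakk>
        \<Longrightarrow> g \<cdot> Add A f f' = Add A (g \<cdot> f) (g \<cdot> f')"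
    and Add_Comp:
      "\<lbrakk>f \<in> Hom A X Y; g \<in> Hom A Y Z; g' \<in> Hom A Y Z\<rbrakk>
        \<Longrightarrow> Add A g g' \<cdot> f = Add A (g \<cdot> f) (g' \<cdot> f)"

definition is_zero_object :: "('o, 'm) precat \<Rightarrow> 'o \<Rightarrow> bool" where
  "is_zero_object A N \<longleftrightarrow> N \<in> Obj A \<and>
    (\<forall>X \<in> Obj A. (\<exists>!f. f \<in> Hom A N X) \<and> (\<exists>!f. f \<in> Hom A X N))"

definition is_biproduct ::
  "('o, 'm) precat \<Rightarrow> 'o \<Rightarrow> 'o \<Rightarrow> 'o \<Rightarrow> 'm \<Rightarrow> 'm \<Rightarrow> 'm \<Rightarrow> 'm \<Rightarrow> bool" where
  "is_biproduct A X Y P i j p q \<longleftrightarrow> P \<in> Obj A \<and>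
    i \<in> Hom A X P \<and> j \<in> Hom A Y P \<and> p \<in> Hom A P X \<and> q \<in> Hom A P Y \<and>
    p \<cdot>\<^bsub>A\<^esub> i = Ide A X \<and> q \<cdot>\<^bsub>A\<^esub> j = Ide A Y \<and>
    p \<cdot>\<^bsub>A\<^esub> j = Zero A Y X \<and> q \<cdot>\<^bsub>A\<^esub> i = Zero A X Y \<and>
    Add A (i \<cdot>\<^bsub>A\<^esub> p) (j \<cdot>\<^bsub>A\<^esub> q) = Ide A P"

locale additive_category = preadditive_category +
  assumes ex_zero_object: "\<exists>N. is_zero_object A N"
    and ex_biproduct:
      "\<lbrakk>X \<in> Obj A; Y \<in> Obj A\<rbrakk> \<Longrightarrow> \<exists>P i j p q. is_biproduct A X Y P i j p q"

definition is_kernel :: "('o, 'm) precat \<Rightarrow> 'm \<Rightarrow> 'm \<Rightarrow> bool" where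
  "is_kernel A k f \<longleftrightarrow> k \<in> Arr A \<and> f \<in> Arr A \<and> Cod A k = Dom A f \<and>
    f \<cdot>\<^bsub>A\<^esub> k = Zero A (Dom A k) (Cod A f) \<and>
    (\<forall>W. \<forall>u \<in> Hom A W (Dom A f). f \<cdot>\<^bsub>A\<^esub> u = Zero A W (Cod A f) \<longrightarrow>
      (\<exists>!v. v \<in> Hom A W (Dom A k) \<and> k \<cdot>\<^bsub>A\<^esub> v = u))"

definition is_cokernel :: "('o, 'm) precat \<Rightarrow> 'm \<Rightarrow> 'm \<Rightarrow> bool" where
  "is_cokernel A c f \<longleftrightarrow> c \<in> Arr A \<and> f \<in> Arr A \<and> Dom A c = Cod A f \<and>
    c \<cdot>\<^bsub>A\<^esub> f = Zero A (Dom A f) (Cod A c) \<and>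
    (\<forall>W. \<forall>u \<in> Hom A (Cod A f) W. u \<cdot>\<^bsub>A\<^esub> f = Zero A (Dom A f) W \<longrightarrow>
      (\<exists>!v. v \<in> Hom A (Cod A c) W \<and> v \<cdot>\<^bsub>A\<^esub> c = u))"

locale pre_abelian_category = additive_category +
  assumes ex_kernel: "f \<in> Arr A \<Longrightarrow> \<exists>k. is_kernel A k f"
    and ex_cokernel: "f \<in> Arr A \<Longrightarrow> \<exists>c. is_cokernel A c f"

definition is_mono :: "('o, 'm) precat \<Rightarrow> 'm \<Rightarrow> bool" where
  "is_mono A f \<longleftrightarrow> f \<in> Arr A \<and>
    (\<forall>W. \<forall>u \<in> Hom A W (Dom A f). \<forall>v \<in> Hom A W (Dom A f).
      f \<cdot>\<^bsub>A\<^esub> u = f \<cdot>\<^bsub>A\<^esub> v \<longrightarrow> u = v)"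

definition is_epi :: "('o, 'm) precat \<Rightarrow> 'm \<Rightarrow> bool" where
  "is_epi A f \<longleftrightarrow> f \<in> Arr A \<and>
    (\<forall>W. \<forall>u \<in> Hom A (Cod A f) W. \<forall>v \<in> Hom A (Cod A f) W.
      u \<cdot>\<^bsub>A\<^esub> f = v \<cdot>\<^bsub>A\<^esub> f \<longrightarrow> u = v)"

locale abelian_category = pre_abelian_category +
  assumes mono_is_kernel: "is_mono A f \<Longrightarrow> \<exists>g. is_kernel A f g"
    and epi_is_cokernel: "is_epi A f \<Longrightarrow> \<exists>g. is_cokernel A f g"

text \<open>\<open>is_pullback A p q f g\<close>: the square with \<open>p : P \<rightarrow> X\<close>, \<open>q : P \<rightarrow> Y\<close>, \<open>f : X \<rightarrow> Z\<close>,
  \<open>g : Y \<rightarrow> Z\<close> is cartesian.  In particular \<open>q\<close> is the base change of \<open>f\<close> along \<open>g\<close>.\<close>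

definition is_pullback :: "('o, 'm) precat \<Rightarrow> 'm \<Rightarrow> 'm \<Rightarrow> 'm \<Rightarrow> 'm \<Rightarrow> bool" where
  "is_pullback A p q f g \<longleftrightarrow> {p, q, f, g} \<subseteq> Arr A \<and>
    Dom A p = Dom A q \<and> Cod A p = Dom A f \<and> Cod A q = Dom A g \<and> Cod A f = Cod A g \<and>
    f \<cdot>\<^bsub>A\<^esub> p = g \<cdot>\<^bsub>A\<^esub> q \<and>
    (\<forall>W. \<forall>u \<in> Hom A W (Dom A f). \<forall>v \<in> Hom A W (Dom A g). f \<cdot>\<^bsub>A\<^esub> u = g \<cdot>\<^bsub>A\<^esub> v \<longrightarrow>
      (\<exists>!w. w \<in> Hom A W (Dom A p) \<and> p \<cdot>\<^bsub>A\<^esub> w = u \<and> q \<cdot>\<^bsub>A\<^esub> w = v))"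

text \<open>Dually, \<open>is_pushout A p q f g\<close> has \<open>f : Z \<rightarrow> X\<close>, \<open>g : Z \<rightarrow> Y\<close>, \<open>p : X \<rightarrow> P\<close>,
  \<open>q : Y \<rightarrow> P\<close>, and \<open>q\<close> is the cobase change of \<open>f\<close> along \<open>g\<close>.\<close>

definition is_pushout :: "('o, 'm) precat \<Rightarrow> 'm \<Rightarrow> 'm \<Rightarrow> 'm \<Rightarrow> 'm \<Rightarrow> bool" where
  "is_pushout A p q f g \<longleftrightarrow> {p, q, f, g} \<subseteq> Arr A \<and>
    Cod A p = Cod A q \<and> Dom A p = Cod A f \<and> Dom A q = Cod A g \<and> Dom A f = Dom A g \<and>
    p \<cdot>\<^bsub>A\<^esub> f = q \<cdot>\<^bsub>A\<^esub> g \<and>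
    (\<forall>W. \<forall>u \<in> Hom A (Cod A f) W. \<forall>v \<in> Hom A (Cod A g) W. u \<cdot>\<^bsub>A\<^esub> f = v \<cdot>\<^bsub>A\<^esub> g \<longrightarrow>
      (\<exists>!w. w \<in> Hom A (Cod A p) W \<and> w \<cdot>\<^bsub>A\<^esub> p = u \<and> w \<cdot>\<^bsub>A\<^esub> q = v))"

locale quasi_abelian_category = pre_abelian_category +
  assumes cokernel_pullback:
      "\<lbrakk>is_pullback A p q f g; is_cokernel A f h\<rbrakk> \<Longrightarrow> \<exists>h'. is_cokernel A q h'"
    and kernel_pushout:
      "\<lbrakk>is_pushout A p q f g; is_kernel A f h\<rbrakk> \<Longrightarrow> \<exists>h'. is_kernel A q h'"

definition short_exact :: "('o, 'm) precat \<Rightarrow> 'o \<Rightarrow> 'm \<Rightarrow> 'o \<Rightarrow> 'm \<Rightarrow> 'o \<Rightarrow> bool" where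
  "short_exact A X f Y g Z \<longleftrightarrow>
    f \<in> Hom A X Y \<and> g \<in> Hom A Y Z \<and> is_kernel A f g \<and> is_cokernel A g f"

definition isomorphic :: "('o, 'm) precat \<Rightarrow> 'o \<Rightarrow> 'o \<Rightarrow> bool" where
  "isomorphic A X Y \<longleftrightarrow> X \<in> Obj A \<and> Y \<in> Obj A \<and>
    (\<exists>f \<in> Hom A X Y. \<exists>g \<in> Hom A Y X. g \<cdot>\<^bsub>A\<^esub> f = Ide A X \<and> f \<cdot>\<^bsub>A\<^esub> g = Ide A Y)"

definition iso_closed :: "('o, 'm) precat \<Rightarrow> 'o set \<Rightarrow> bool" where
  "iso_closed A S \<longleftrightarrow> (\<forall>X \<in> S. \<forall>Y. isomorphic A X Y \<longrightarrow> Y \<in> S)"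

text \<open>A full subcategory is determined by, and below identified with, its set of objects;
  \<open>full_subcat\<close> turns such a set into a category.\<close>

definition full_subcat :: "('o, 'm) precat \<Rightarrow> 'o set \<Rightarrow> ('o, 'm) precat" where
  "full_subcat A S = A\<lparr>Obj := Obj A \<inter> S, Arr := {f \<in> Arr A. Dom A f \<in> S \<and> Cod A f \<in> S}\<rparr>"

definition torsion_pair :: "('o, 'm) precat \<Rightarrow> 'o set \<Rightarrow> 'o set \<Rightarrow> bool" where
  "torsion_pair B T F \<longleftrightarrow> T \<subseteq> Obj B \<and> F \<subseteq> Obj B \<and> iso_closed B T \<and> iso_closed B F \<and>
    (\<forall>X \<in> T. \<forall>Y \<in> F. Hom B X Y = {Zero B X Y}) \<and>
    (\<forall>M \<in> Obj B. \<exists>X \<in> T. \<exists>Y \<in> F. \<exists>f g. short_exact B X f M g Y)"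

definition ext_star :: "('o, 'm) precat \<Rightarrow> 'o set \<Rightarrow> 'o set \<Rightarrow> 'o set" where
  "ext_star A U V = {M \<in> Obj A. \<exists>X \<in> U. \<exists>Y \<in> V. \<exists>f g. short_exact A X f M g Y}"

end

theory Submission
  imports Defs
begin

text \<open>
  Write \<open>H = C' \<inter> D\<close>.  Every notion in sight is self-dual: passing to the opposite category
  exchanges torsion and torsionfree classes, kernels and cokernels, pullbacks and pushouts, and turns
  the interval \<open>(C, D) \<le> (C', D')\<close> into \<open>(D', C') \<le> (D, C)\<close>, with the same \<open>H\<close>.  So only
  one half of each argument is carried out.

  \<^emph>\<open>\<open>H\<close> is quasi-abelian.\<close>  The kernel of \<open>f\<close> in \<open>H\<close> is the \<open>C'\<close>-torsion part of its kernel
  in \<open>A\<close>; dually, the cokernel in \<open>H\<close> is the \<open>D\<close>-torsionfree quotient of the cokernel in \<open>A\<close>.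
  The main point (\<open>cokernel_heart_short_exact\<close>) is that a cokernel in \<open>H\<close> is an
  epimorphism of \<open>A\<close> whose kernel in \<open>A\<close> lies in \<open>H\<close>.  Indeed, if it is the cokernel of
  \<open>h : W \<rightarrow> X\<close>, then its kernel in \<open>A\<close> is an extension of the \<open>C\<close>-torsion part of \<open>coker h\<close> by the
  image of \<open>h\<close>, a quotient of \<open>W\<close>; both are in \<open>C'\<close>, as \<open>C \<subseteq> C'\<close>.  Epimorphisms of \<open>A\<close> are stable
  under pullback with unchanged kernel, and \<open>C'\<close> and \<open>D\<close> are closed under extensions, so a
  pullback along such a morphism stays in \<open>H\<close>, and cokernels in \<open>H\<close> are stable under pullback.

  \<^emph>\<open>The correspondence.\<close>  A consequence of the main point is that a short exact sequence of \<open>H\<close> is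
  short exact in \<open>A\<close>, so a torsion pair \<open>(T, F)\<close> of \<open>H\<close> satisfies \<open>H = T * F\<close> in \<open>A\<close>.  The
  operation \<open>*\<close> is associative (\<open>ext_star_assoc1\<close>, \<open>ext_star_assoc2\<close>), and \<open>C' = C * H\<close>.  Hence
  \<open>A = C' * D' = (C * (T * F)) * D' = (C * T) * (F * D')\<close>,
  which is the decomposition axiom for the torsion pair \<open>(C * T, F * D')\<close>; orthogonality passes from
  the factors to \<open>*\<close>.  In the other direction a torsion pair of \<open>A\<close> in the interval simply
  restricts to \<open>H\<close>.  Each class of a torsion pair is the orthogonal of the other, so two torsion
  pairs \<open>(T, F)\<close> and \<open>(T', F')\<close> with \<open>T \<subseteq> T'\<close> and \<open>F \<subseteq> F'\<close> are equal; this gives both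
  round trips with only the easy inclusions to check.
\<close>

section \<open>Duality\<close>

definition opp :: "('o, 'm) precat \<Rightarrow> ('o, 'm) precat" where
  "opp A = \<lparr>Obj = Obj A, Arr = Arr A, Dom = Cod A, Cod = Dom A, Ide = Ide A,
    Comp = (\<lambda>g f. f \<cdot>\<^bsub>A\<^esub> g), Add = Add A, Zero = (\<lambda>X Y. Zero A Y X)\<rparr>"

lemma opp_simps [simp]:
  "Obj (opp A) = Obj A" "Arr (opp A) = Arr A" "Dom (opp A) = Cod A" "Cod (opp A) = Dom A"
  "Ide (opp A) = Ide A" "g \<cdot>\<^bsub>opp A\<^esub> f = f \<cdot>\<^bsub>A\<^esub> g" "Add (opp A) = Add A"
  "Zero (opp A) X Y = Zero A Y X"
  by (simp_all add: opp_def)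

lemma Hom_opp [simp]: "Hom (opp A) X Y = Hom A Y X"
  by (auto simp: Hom_def)

lemma is_kernel_opp [simp]: "is_kernel (opp A) k f \<longleftrightarrow> is_cokernel A k f"
  by (auto simp: is_kernel_def is_cokernel_def)

lemma is_cokernel_opp [simp]: "is_cokernel (opp A) c f \<longleftrightarrow> is_kernel A c f"
  by (auto simp: is_kernel_def is_cokernel_def)

lemma is_mono_opp [simp]: "is_mono (opp A) f \<longleftrightarrow> is_epi A f"
  by (simp add: is_mono_def is_epi_def)

lemma is_epi_opp [simp]: "is_epi (opp A) f \<longleftrightarrow> is_mono A f"
  by (simp add: is_mono_def is_epi_def)

lemma is_zero_object_opp [simp]: "is_zero_object (opp A) N \<longleftrightarrow> is_zero_object A N"
  by (auto simp: is_zero_object_def)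

lemma is_biproduct_opp [simp]:
  "is_biproduct (opp A) X Y P p q i j \<longleftrightarrow> is_biproduct A X Y P i j p q"
  by (auto simp: is_biproduct_def)

lemma is_pullback_opp [simp]: "is_pullback (opp A) p q f g \<longleftrightarrow> is_pushout A p q f g"
  by (simp add: is_pullback_def is_pushout_def)

lemma short_exact_opp [simp]: "short_exact (opp A) X f Y g Z \<longleftrightarrow> short_exact A Z g Y f X"
  by (auto simp: short_exact_def)

lemma iso_closed_opp [simp]: "iso_closed (opp A) S \<longleftrightarrow> iso_closed A S"
  unfolding iso_closed_def isomorphic_def by (simp add: Bex_def) blast

lemma full_subcat_opp [simp]: "full_subcat (opp A) S = opp (full_subcat A S)"
  by (auto simp: full_subcat_def opp_def)

lemma torsion_pair_opp [simp]: "torsion_pair (opp A) F T \<longleftrightarrow> torsion_pair A T F"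
  unfolding torsion_pair_def by (simp, blast)

lemma ext_star_opp [simp]: "ext_star (opp A) V U = ext_star A U V"
  unfolding ext_star_def by (simp, blast)

lemma category_opp: "category A \<Longrightarrow> category (opp A)"
  unfolding category_def by (simp, metis)

lemma preadditive_category_opp:
  assumes "preadditive_category A" shows "preadditive_category (opp A)"
proof -
  interpret preadditive_category A by fact
  have [simp]: "hom_group (opp A) X Y = hom_group A Y X" for X Y
    by (simp add: hom_group_def)
  show ?thesis
    by (intro preadditive_category.intro category_opp category_axioms
        preadditive_category_axioms.intro) (simp_all add: Hom_comm_group Comp_Add Add_Comp)
qed

lemma abelian_category_opp:
  assumes "abelian_category A" shows "abelian_category (opp A)"
proof -
  interpret abelian_category A by fact
  show ?thesis
  proof (intro abelian_category.intro pre_abelian_category.intro additive_category.intro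
      preadditive_category_opp preadditive_category_axioms)
    show "additive_category_axioms (opp A)"
      using ex_zero_object ex_biproduct
      by (unfold_locales; simp) metis
    show "pre_abelian_category_axioms (opp A)"
      using ex_kernel ex_cokernel by unfold_locales simp_all
    show "abelian_category_axioms (opp A)"
      using mono_is_kernel epi_is_cokernel by unfold_locales simp_all
  qed
qed

section \<open>Zero morphisms, kernels and short exact sequences\<close>

context category begin

lemma Hom_Obj: "f \<in> Hom A X Y \<Longrightarrow> X \<in> Obj A" "f \<in> Hom A X Y \<Longrightarrow> Y \<in> Obj A"
  using Dom_closed Cod_closed by (auto simp: Hom_def)

end

context preadditive_category begin

lemma opp_preadditive: "preadditive_category (opp A)"
  using preadditive_category_opp preadditive_category_axioms .

lemma Zero_closed: "\<lbrakk>X \<in> Obj A; Y \<in> Obj A\<rbrakk> \<Longrightarrow> Zero A X Y \<in> Hom A X Y"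
  using comm_group.axioms(2)[OF Hom_comm_group] group.is_monoid monoid.one_closed
  by (fastforce simp: hom_group_def)

lemma Add_closed: "\<lbrakk>f \<in> Hom A X Y; g \<in> Hom A X Y\<rbrakk> \<Longrightarrow> Add A f g \<in> Hom A X Y"
  using monoid.m_closed[OF group.is_monoid[OF comm_group.axioms(2)[OF Hom_comm_group[of X Y]]]]
    Hom_Obj
  by (auto simp: hom_group_def)

lemma Add_right_cancel:
  "\<lbrakk>f \<in> Hom A X Y; g \<in> Hom A X Y; h \<in> Hom A X Y\<rbrakk> \<Longrightarrow> Add A f h = Add A g h \<longleftrightarrow> f = g"
  using group.right_cancel[OF comm_group.axioms(2)[OF Hom_comm_group[of X Y]]] Hom_Obj
  by (auto simp: hom_group_def)

lemma Add_Zero_left: "f \<in> Hom A X Y \<Longrightarrow> Add A (Zero A X Y) f = f"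
  using monoid.l_one[OF group.is_monoid[OF comm_group.axioms(2)[OF Hom_comm_group[of X Y]]]]
    Hom_Obj
  by (auto simp: hom_group_def)

lemma Add_Zero_right: "f \<in> Hom A X Y \<Longrightarrow> Add A f (Zero A X Y) = f"
  using monoid.r_one[OF group.is_monoid[OF comm_group.axioms(2)[OF Hom_comm_group[of X Y]]]]
    Hom_Obj
  by (auto simp: hom_group_def)

lemma ex_negative:
  assumes "f \<in> Hom A X Y"
  shows "\<exists>g \<in> Hom A X Y. Add A f g = Zero A X Y"
  using group.r_inv_ex[OF comm_group.axioms(2)[OF Hom_comm_group[of X Y]], of f] Hom_Obj assms
  by (auto simp: hom_group_def)

lemma Comp_Zero:
  assumes g: "g \<in> Hom A Y Z" and X: "X \<in> Obj A"
  shows "g \<cdot> Zero A X Y = Zero A X Z"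
proof -
  have z: "Zero A X Y \<in> Hom A X Y" "Zero A X Z \<in> Hom A X Z"
    using Zero_closed[OF X] Hom_Obj[OF g] by simp_all
  have gz: "g \<cdot> Zero A X Y \<in> Hom A X Z"
    using Comp_closed[OF z(1) g] .
  have "Add A (g \<cdot> Zero A X Y) (g \<cdot> Zero A X Y) = Add A (Zero A X Z) (g \<cdot> Zero A X Y)"
    using Comp_Add[OF z(1) z(1) g] Add_Zero_left[OF z(1)] Add_Zero_left[OF gz] by simp
  then show ?thesis
    using Add_right_cancel[OF gz z(2) gz] by simp
qed

lemma Zero_Comp:
  assumes "f \<in> Hom A X Y" "Z \<in> Obj A"
  shows "Zero A Y Z \<cdot> f = Zero A X Z"
  using preadditive_category.Comp_Zero[OF opp_preadditive]
    assms by fastforce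

lemma is_kernelI:
  assumes "k \<in> Hom A K X" "f \<in> Hom A X Y" "f \<cdot> k = Zero A K Y"
    and "\<And>W u. \<lbrakk>u \<in> Hom A W X; f \<cdot> u = Zero A W Y\<rbrakk> \<Longrightarrow> \<exists>v \<in> Hom A W K. k \<cdot> v = u"
    and "\<And>W v v'. \<lbrakk>v \<in> Hom A W K; v' \<in> Hom A W K; k \<cdot> v = k \<cdot> v'\<rbrakk> \<Longrightarrow> v = v'"
  shows "is_kernel A k f"
proof -
  have t: "k \<in> Arr A" "f \<in> Arr A" "Dom A k = K" "Cod A k = X" "Dom A f = X" "Cod A f = Y"
    using assms(1,2) by (auto simp: Hom_def)
  show ?thesis
    unfolding is_kernel_def t using t assms(3-5) by (auto; metis)
qed

lemma is_cokernelI: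
  assumes "c \<in> Hom A Y Q" "f \<in> Hom A X Y" "c \<cdot> f = Zero A X Q"
    and "\<And>W u. \<lbrakk>u \<in> Hom A Y W; u \<cdot> f = Zero A X W\<rbrakk> \<Longrightarrow> \<exists>v \<in> Hom A Q W. v \<cdot> c = u"
    and "\<And>W v v'. \<lbrakk>v \<in> Hom A Q W; v' \<in> Hom A Q W; v \<cdot> c = v' \<cdot> c\<rbrakk> \<Longrightarrow> v = v'"
  shows "is_cokernel A c f"
  using preadditive_category.is_kernelI[OF opp_preadditive,
      of c Q Y f X] assms by simp

lemma kernel_Comp:
  "\<lbrakk>is_kernel A k f; k \<in> Hom A K X; f \<in> Hom A X Y\<rbrakk> \<Longrightarrow> f \<cdot> k = Zero A K Y"
  by (auto simp: is_kernel_def Hom_def)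

lemma kernel_factor:
  assumes "is_kernel A k f" "k \<in> Hom A K X" "f \<in> Hom A X Y" "u \<in> Hom A W X" "f \<cdot> u = Zero A W Y"
  obtains v where "v \<in> Hom A W K" "k \<cdot> v = u"
proof -
  have t: "Dom A k = K" "Dom A f = X" "Cod A f = Y"
    using assms(2,3) by (auto simp: Hom_def)
  show thesis
    using assms(1,4,5) that unfolding is_kernel_def t by blast
qed

lemma kernel_cancel:
  assumes k: "is_kernel A k f" "k \<in> Hom A K X"
    and v: "v \<in> Hom A W K" "v' \<in> Hom A W K" "k \<cdot> v = k \<cdot> v'"
  shows "v = v'"
proof -
  obtain Y where f: "f \<in> Hom A X Y"
    using k by (auto simp: is_kernel_def Hom_def)
  have "f \<cdot> (k \<cdot> v) = Zero A W Y"
    using Comp_assoc[OF v(1) k(2) f] kernel_Comp[OF k f] Zero_Comp[OF v(1)] Hom_Obj(2)[OF f] by simp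
  moreover have "k \<cdot> v \<in> Hom A W X"
    using Comp_closed k v by blast
  moreover have "Dom A k = K" "Dom A f = X" "Cod A f = Y"
    using k(2) f by (auto simp: Hom_def)
  ultimately have "\<exists>!w. w \<in> Hom A W K \<and> k \<cdot> w = k \<cdot> v"
    using k(1) unfolding is_kernel_def by simp
  from the1_equality[OF this, of v] the1_equality[OF this, of v'] show ?thesis
    using v by simp
qed

lemma cokernel_Comp:
  "\<lbrakk>is_cokernel A c f; c \<in> Hom A Y Q; f \<in> Hom A X Y\<rbrakk> \<Longrightarrow> c \<cdot> f = Zero A X Q"
  by (auto simp: is_cokernel_def Hom_def)

lemma cokernel_factor:
  assumes "is_cokernel A c f" "c \<in> Hom A Y Q" "f \<in> Hom A X Y" "u \<in> Hom A Y W" "u \<cdot> f = Zero A X W"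
  obtains v where "v \<in> Hom A Q W" "v \<cdot> c = u"
  using preadditive_category.kernel_factor[OF opp_preadditive,
      of c f Q Y X u W] assms by auto

lemma cokernel_cancel:
  assumes "is_cokernel A c f" "c \<in> Hom A Y Q"
    and "v \<in> Hom A Q W" "v' \<in> Hom A Q W" "v \<cdot> c = v' \<cdot> c"
  shows "v = v'"
  using preadditive_category.kernel_cancel[OF opp_preadditive,
      of c f Q Y v W v'] assms by simp

lemma mono_cancel:
  "\<lbrakk>is_mono A k; k \<in> Hom A K X; v \<in> Hom A W K; v' \<in> Hom A W K; k \<cdot> v = k \<cdot> v'\<rbrakk> \<Longrightarrow> v = v'"
  unfolding is_mono_def by (auto simp: Hom_def)

lemma epi_cancel:
  "\<lbrakk>is_epi A e; e \<in> Hom A X Q; v \<in> Hom A Q W; v' \<in> Hom A Q W; v \<cdot> e = v' \<cdot> e\<rbrakk> \<Longrightarrow> v = v'"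
  unfolding is_epi_def by (auto simp: Hom_def)

lemma is_monoI:
  assumes "k \<in> Hom A K X"
    and "\<And>W v v'. \<lbrakk>v \<in> Hom A W K; v' \<in> Hom A W K; k \<cdot> v = k \<cdot> v'\<rbrakk> \<Longrightarrow> v = v'"
  shows "is_mono A k"
  using assms unfolding is_mono_def by (auto simp: Hom_def)

lemma is_epiI:
  assumes "e \<in> Hom A X Q"
    and "\<And>W v v'. \<lbrakk>v \<in> Hom A Q W; v' \<in> Hom A Q W; v \<cdot> e = v' \<cdot> e\<rbrakk> \<Longrightarrow> v = v'"
  shows "is_epi A e"
  using assms unfolding is_epi_def by (auto simp: Hom_def)

lemma kernel_is_mono:
  assumes "is_kernel A k f" shows "is_mono A k"
proof -
  have k: "k \<in> Hom A (Dom A k) (Cod A k)" using assms by (simp add: is_kernel_def Hom_def)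
  show ?thesis by (rule is_monoI[OF k]) (rule kernel_cancel[OF assms k])
qed

lemma cokernel_is_epi: "is_cokernel A c f \<Longrightarrow> is_epi A c"
  using preadditive_category.kernel_is_mono[OF opp_preadditive,
      of c f] by simp

lemma is_epi_if_zero_test:
  assumes e: "e \<in> Hom A X Q"
    and zero: "\<And>W a. \<lbrakk>a \<in> Hom A Q W; a \<cdot> e = Zero A X W\<rbrakk> \<Longrightarrow> a = Zero A Q W"
  shows "is_epi A e"
proof (rule is_epiI[OF e])
  fix W v v' assume v: "v \<in> Hom A Q W" "v' \<in> Hom A Q W" "v \<cdot> e = v' \<cdot> e"
  obtain n where n: "n \<in> Hom A Q W" "Add A v' n = Zero A Q W"
    using ex_negative[OF v(2)] by blast
  have "Add A v n \<cdot> e = Add A v' n \<cdot> e"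
    using Add_Comp[OF e v(1) n(1)] Add_Comp[OF e v(2) n(1)] v(3) by simp
  then have "Add A v n \<cdot> e = Zero A X W"
    using n(2) Zero_Comp[OF e Hom_Obj(2)[OF v(1)]] by simp
  then have "Add A v n = Add A v' n"
    using zero[OF Add_closed[OF v(1) n(1)]] n(2) by simp
  then show "v = v'" using Add_right_cancel[OF v(1,2) n(1)] by simp
qed

lemma mono_Comp:
  assumes "is_mono A k" "k \<in> Hom A K X" "is_mono A l" "l \<in> Hom A X Y"
  shows "is_mono A (l \<cdot> k)"
proof (rule is_monoI)
  show "l \<cdot> k \<in> Hom A K Y" using Comp_closed[OF assms(2,4)] .
  fix W v v' assume v: "v \<in> Hom A W K" "v' \<in> Hom A W K" "(l \<cdot> k) \<cdot> v = (l \<cdot> k) \<cdot> v'"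
  have "l \<cdot> (k \<cdot> v) = l \<cdot> (k \<cdot> v')"
    using Comp_assoc[OF v(1) assms(2,4)] Comp_assoc[OF v(2) assms(2,4)] v(3) by simp
  then have "k \<cdot> v = k \<cdot> v'"
    using mono_cancel[OF assms(3,4) Comp_closed[OF v(1) assms(2)] Comp_closed[OF v(2) assms(2)]]
    by simp
  then show "v = v'" using mono_cancel[OF assms(1,2) v(1,2)] by simp
qed

lemma epi_Comp:
  assumes "is_epi A d" "d \<in> Hom A X Y" "is_epi A e" "e \<in> Hom A Y Z"
  shows "is_epi A (e \<cdot> d)"
  using preadditive_category.mono_Comp[OF opp_preadditive,
      of e Z Y d X] assms by simp

lemma short_exact_iso:
  assumes s: "short_exact A X f M g Z"
    and i: "i \<in> Hom A M N" "j \<in> Hom A N M" "j \<cdot> i = Ide A M" "i \<cdot> j = Ide A N"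
  shows "short_exact A X (i \<cdot> f) N (g \<cdot> j) Z"
proof -
  have f: "f \<in> Hom A X M" and g: "g \<in> Hom A M Z"
    and k: "is_kernel A f g" and c: "is_cokernel A g f"
    using s by (auto simp: short_exact_def)
  have F: "i \<cdot> f \<in> Hom A X N" and G: "g \<cdot> j \<in> Hom A N Z"
    using Comp_closed[OF f i(1)] Comp_closed[OF i(2) g] .
  have ji: "j \<cdot> (i \<cdot> u) = u" if "u \<in> Hom A W M" for W u
    using Comp_assoc[OF that i(1,2)] Ide_Comp[OF that] i(3) by simp
  have ij: "i \<cdot> (j \<cdot> u) = u" if "u \<in> Hom A W N" for W u
    using Comp_assoc[OF that i(2,1)] Ide_Comp[OF that] i(4) by simp
  have ji': "(u \<cdot> j) \<cdot> i = u" if "u \<in> Hom A M W" for W u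
    using Comp_assoc[OF i(1,2) that] Comp_Ide[OF that] i(3) by simp
  have ij': "(u \<cdot> i) \<cdot> j = u" if "u \<in> Hom A N W" for W u
    using Comp_assoc[OF i(2,1) that] Comp_Ide[OF that] i(4) by simp
  have GF: "(g \<cdot> j) \<cdot> (i \<cdot> f) = Zero A X Z"
    using Comp_assoc[OF F i(2) g] ji[OF f] kernel_Comp[OF k f g] by simp
  have "is_kernel A (i \<cdot> f) (g \<cdot> j)"
  proof (rule is_kernelI[OF F G GF])
    fix W u assume u: "u \<in> Hom A W N" "(g \<cdot> j) \<cdot> u = Zero A W Z"
    have "j \<cdot> u \<in> Hom A W M" "g \<cdot> (j \<cdot> u) = Zero A W Z"
      using Comp_closed[OF u(1) i(2)] Comp_assoc[OF u(1) i(2) g] u by simp_all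
    then obtain v where v: "v \<in> Hom A W X" "f \<cdot> v = j \<cdot> u"
      using kernel_factor[OF k f g] by blast
    then have "(i \<cdot> f) \<cdot> v = u"
      using Comp_assoc[OF v(1) f i(1)] ij[OF u(1)] by simp
    then show "\<exists>v \<in> Hom A W X. (i \<cdot> f) \<cdot> v = u" by (rule bexI[OF _ v(1)])
  next
    fix W v v' assume v: "v \<in> Hom A W X" "v' \<in> Hom A W X" "(i \<cdot> f) \<cdot> v = (i \<cdot> f) \<cdot> v'"
    have "f \<cdot> x = j \<cdot> ((i \<cdot> f) \<cdot> x)" if "x \<in> Hom A W X" for x
      using Comp_assoc[OF that f i(1)] ji[OF Comp_closed[OF that f]] by simp
    from this[OF v(1)] this[OF v(2)] have "f \<cdot> v = f \<cdot> v'" by (simp only: v(3))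
    then show "v = v'" using kernel_cancel[OF k f v(1,2)] by simp
  qed
  moreover have "is_cokernel A (g \<cdot> j) (i \<cdot> f)"
  proof (rule is_cokernelI[OF G F GF])
    fix W u assume u: "u \<in> Hom A N W" "u \<cdot> (i \<cdot> f) = Zero A X W"
    have "u \<cdot> i \<in> Hom A M W" "(u \<cdot> i) \<cdot> f = Zero A X W"
      using Comp_closed[OF i(1) u(1)] Comp_assoc[OF f i(1) u(1)] u by simp_all
    then obtain v where v: "v \<in> Hom A Z W" "v \<cdot> g = u \<cdot> i"
      using cokernel_factor[OF c g f] by blast
    then have "v \<cdot> (g \<cdot> j) = u"
      using Comp_assoc[OF i(2) g v(1)] ij'[OF u(1)] by simp
    then show "\<exists>v \<in> Hom A Z W. v \<cdot> (g \<cdot> j) = u" by (rule bexI[OF _ v(1)])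
  next
    fix W v v' assume v: "v \<in> Hom A Z W" "v' \<in> Hom A Z W" "v \<cdot> (g \<cdot> j) = v' \<cdot> (g \<cdot> j)"
    have "x \<cdot> g = (x \<cdot> (g \<cdot> j)) \<cdot> i" if "x \<in> Hom A Z W" for x
      using Comp_assoc[OF i(2) g that] ji'[OF Comp_closed[OF g that]] by simp
    from this[OF v(1)] this[OF v(2)] have "v \<cdot> g = v' \<cdot> g" by (simp only: v(3))
    then show "v = v'" using cokernel_cancel[OF c g v(1,2)] by simp
  qed
  ultimately show ?thesis using F G by (simp add: short_exact_def)
qed

lemma short_exact_Obj:
  "short_exact A X f M g Y \<Longrightarrow> X \<in> Obj A \<and> M \<in> Obj A \<and> Y \<in> Obj A"
  using Hom_Obj[of f X M] Hom_Obj[of g M Y] by (simp add: short_exact_def)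

lemma ext_starI: "\<lbrakk>short_exact A X f M g Y; X \<in> U; Y \<in> V\<rbrakk> \<Longrightarrow> M \<in> ext_star A U V"
  using short_exact_Obj unfolding ext_star_def by auto

lemma ext_star_mono: "\<lbrakk>U \<subseteq> U'; V \<subseteq> V'\<rbrakk> \<Longrightarrow> ext_star A U V \<subseteq> ext_star A U' V'"
  by (auto simp: ext_star_def)

lemma iso_closed_ext_star: "iso_closed A (ext_star A U V)"
proof -
  have "N \<in> ext_star A U V" if M: "M \<in> ext_star A U V" and "isomorphic A M N" for M N
  proof -
    from that obtain i j where i: "i \<in> Hom A M N" "j \<in> Hom A N M" "j \<cdot> i = Ide A M" "i \<cdot> j = Ide A N"
      by (auto simp: isomorphic_def)
    from M obtain X f g Y where s: "short_exact A X f M g Y" "X \<in> U" "Y \<in> V"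
      by (auto simp: ext_star_def)
    show ?thesis using ext_starI[OF short_exact_iso[OF s(1) i] s(2,3)] .
  qed
  then show ?thesis by (auto simp: iso_closed_def)
qed

end

section \<open>Biproducts and pullbacks\<close>

context preadditive_category begin

lemma biproduct_cancel:
  assumes b: "is_biproduct A X Y B i j p q"
    and w: "w \<in> Hom A W B" "w' \<in> Hom A W B" "p \<cdot> w = p \<cdot> w'" "q \<cdot> w = q \<cdot> w'"
  shows "w = w'"
proof -
  have t: "i \<in> Hom A X B" "j \<in> Hom A Y B" "p \<in> Hom A B X" "q \<in> Hom A B Y"
    "Add A (i \<cdot> p) (j \<cdot> q) = Ide A B"
    using b by (auto simp: is_biproduct_def)
  have "x = Add A (i \<cdot> (p \<cdot> x)) (j \<cdot> (q \<cdot> x))" if x: "x \<in> Hom A W B" for x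
    using Add_Comp[OF x Comp_closed[OF t(3,1)] Comp_closed[OF t(4,2)]] t(5) Ide_Comp[OF x]
      Comp_assoc[OF x t(3,1)] Comp_assoc[OF x t(4,2)] by simp
  from this[OF w(1)] this[OF w(2)] show ?thesis by (simp only: w(3,4))
qed

lemma biproduct_factor:
  assumes b: "is_biproduct A X Y B i j p q" and u: "u \<in> Hom A W X" and v: "v \<in> Hom A W Y"
  obtains w where "w \<in> Hom A W B" "p \<cdot> w = u" "q \<cdot> w = v"
proof -
  have t: "i \<in> Hom A X B" "j \<in> Hom A Y B" "p \<in> Hom A B X" "q \<in> Hom A B Y"
    "p \<cdot> i = Ide A X" "q \<cdot> j = Ide A Y" "p \<cdot> j = Zero A Y X" "q \<cdot> i = Zero A X Y"
    using b by (auto simp: is_biproduct_def)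
  have iu: "i \<cdot> u \<in> Hom A W B" and jv: "j \<cdot> v \<in> Hom A W B"
    using Comp_closed[OF u t(1)] Comp_closed[OF v t(2)] .
  have "p \<cdot> Add A (i \<cdot> u) (j \<cdot> v) = u"
    using Comp_Add[OF iu jv t(3)] Comp_assoc[OF u t(1,3)] Comp_assoc[OF v t(2,3)] t(5,7)
      Ide_Comp[OF u] Zero_Comp[OF v Hom_Obj(2)[OF u]] Add_Zero_right[OF u] by simp
  moreover have "q \<cdot> Add A (i \<cdot> u) (j \<cdot> v) = v"
    using Comp_Add[OF iu jv t(4)] Comp_assoc[OF u t(1,4)] Comp_assoc[OF v t(2,4)] t(6,8)
      Ide_Comp[OF v] Zero_Comp[OF u Hom_Obj(2)[OF v]] Add_Zero_left[OF v] by simp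
  ultimately show thesis using that[OF Add_closed[OF iu jv]] by simp
qed

lemma is_pullbackI:
  assumes "p \<in> Hom A P X" "q \<in> Hom A P Y" "f \<in> Hom A X Z" "g \<in> Hom A Y Z" "f \<cdot> p = g \<cdot> q"
    and ex: "\<And>W u v. \<lbrakk>u \<in> Hom A W X; v \<in> Hom A W Y; f \<cdot> u = g \<cdot> v\<rbrakk>
      \<Longrightarrow> \<exists>w. w \<in> Hom A W P \<and> p \<cdot> w = u \<and> q \<cdot> w = v"
    and eq: "\<And>W w w'. \<lbrakk>w \<in> Hom A W P; w' \<in> Hom A W P; p \<cdot> w = p \<cdot> w'; q \<cdot> w = q \<cdot> w'\<rbrakk> \<Longrightarrow> w = w'"
  shows "is_pullback A p q f g"
proof -
  have t: "p \<in> Arr A" "q \<in> Arr A" "f \<in> Arr A" "g \<in> Arr A" "Dom A p = P" "Dom A q = P"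
    "Cod A p = X" "Cod A q = Y" "Dom A f = X" "Dom A g = Y" "Cod A f = Z" "Cod A g = Z"
    using assms(1-4) by (auto simp: Hom_def)
  have "\<exists>!w. w \<in> Hom A W P \<and> p \<cdot> w = u \<and> q \<cdot> w = v"
    if "u \<in> Hom A W X" "v \<in> Hom A W Y" "f \<cdot> u = g \<cdot> v" for W u v
    using ex[OF that] by (rule ex_ex1I) (rule eq, auto)
  then show ?thesis
    unfolding is_pullback_def t using t(1-4) assms(5) by simp
qed

lemma pullback_factor:
  assumes "is_pullback A p q f g" "p \<in> Hom A P X" "f \<in> Hom A X Z" "g \<in> Hom A Y Z"
    and "u \<in> Hom A W X" "v \<in> Hom A W Y" "f \<cdot> u = g \<cdot> v"
  obtains w where "w \<in> Hom A W P" "p \<cdot> w = u" "q \<cdot> w = v"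
proof -
  have t: "Dom A p = P" "Dom A f = X" "Dom A g = Y"
    using assms(2-4) by (auto simp: Hom_def)
  have "\<forall>W. \<forall>u \<in> Hom A W X. \<forall>v \<in> Hom A W Y. f \<cdot> u = g \<cdot> v \<longrightarrow>
      (\<exists>!w. w \<in> Hom A W P \<and> p \<cdot> w = u \<and> q \<cdot> w = v)"
    using assms(1) unfolding is_pullback_def t by (elim conjE) assumption
  from this[rule_format, OF assms(5-7)] show thesis using that by (elim ex1E conjE)
qed

lemma pullback_cancel:
  assumes pb: "is_pullback A p q f g" "p \<in> Hom A P X" "q \<in> Hom A P Y"
    and w: "w \<in> Hom A W P" "w' \<in> Hom A W P" "p \<cdot> w = p \<cdot> w'" "q \<cdot> w = q \<cdot> w'"
  shows "w = w'"
proof -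
  define Z where "Z = Cod A f"
  have f: "f \<in> Hom A X Z" and g: "g \<in> Hom A Y Z" and fp: "f \<cdot> p = g \<cdot> q"
    using pb by (auto simp: is_pullback_def Hom_def Z_def)
  have t: "Dom A p = P" "Dom A f = X" "Dom A g = Y"
    using pb(2) f g by (auto simp: Hom_def)
  have "f \<cdot> (p \<cdot> w) = g \<cdot> (q \<cdot> w)"
    using Comp_assoc[OF w(1) pb(2) f] Comp_assoc[OF w(1) pb(3) g] fp by simp
  moreover have "\<forall>W. \<forall>u \<in> Hom A W X. \<forall>v \<in> Hom A W Y. f \<cdot> u = g \<cdot> v \<longrightarrow>
      (\<exists>!w. w \<in> Hom A W P \<and> p \<cdot> w = u \<and> q \<cdot> w = v)"
    using pb(1) unfolding is_pullback_def t by (elim conjE) assumption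
  ultimately have "\<exists>!x. x \<in> Hom A W P \<and> p \<cdot> x = p \<cdot> w \<and> q \<cdot> x = q \<cdot> w"
    using Comp_closed[OF w(1) pb(2)] Comp_closed[OF w(1) pb(3)] by simp
  from the1_equality[OF this, of w] the1_equality[OF this, of w'] show ?thesis
    using w by simp
qed

end

section \<open>Abelian categories\<close>

context abelian_category begin

lemma opp: "abelian_category (opp A)"
  using abelian_category_opp abelian_category_axioms .

text \<open>The epimorphism is a cokernel of some \<open>h\<close>, and \<open>h\<close> factors through the kernel \<open>k\<close>, so a
  morphism that kills \<open>k\<close> also kills \<open>h\<close>.\<close>

lemma epi_is_cokernel_of_kernel:
  assumes "is_epi A e" "is_kernel A k e"
  shows "is_cokernel A e k"
proof -
  obtain h where h: "is_cokernel A e h" using epi_is_cokernel assms(1) by blast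
  obtain W X Q where hX: "h \<in> Hom A W X" and eX: "e \<in> Hom A X Q"
    using h by (auto simp: is_cokernel_def Hom_def)
  obtain K where kX: "k \<in> Hom A K X"
    using assms(2) eX by (auto simp: is_kernel_def Hom_def)
  obtain w where w: "w \<in> Hom A W K" "k \<cdot> w = h"
    using kernel_factor[OF assms(2) kX eX hX] cokernel_Comp[OF h eX hX] by blast
  show ?thesis
  proof (rule is_cokernelI[OF eX kX kernel_Comp[OF assms(2) kX eX]])
    fix Y u assume u: "u \<in> Hom A X Y" "u \<cdot> k = Zero A K Y"
    have "u \<cdot> h = Zero A W Y"
      using Comp_assoc[OF w(1) kX u(1)] Zero_Comp[OF w(1) Hom_Obj(2)[OF u(1)]] u(2) w(2) by simp
    then show "\<exists>v \<in> Hom A Q Y. v \<cdot> e = u"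
      using cokernel_factor[OF h eX hX u(1)] by blast
  qed (rule epi_cancel[OF assms(1) eX])
qed

lemma short_exact_kernel:
  "\<lbrakk>e \<in> Hom A X Q; is_epi A e; k \<in> Hom A K X; is_kernel A k e\<rbrakk> \<Longrightarrow> short_exact A K k X e Q"
  by (simp add: short_exact_def epi_is_cokernel_of_kernel)

text \<open>Whether \<open>w : W \<rightarrow> I\<close> is epi can be tested on morphisms defined on an object \<open>X\<close> that
  contains \<open>I\<close>: if \<open>a \<cdot> w = 0\<close>, then the subobject \<open>ker a\<close> of \<open>X\<close> is the kernel of some \<open>q\<close>,
  and the test forces \<open>I\<close> into it.  The maps onto
  images and out of preimages of subobjects are shown to be epimorphisms by this test.\<close>

lemma epi_onto_subobject:
  assumes i: "is_mono A i" "i \<in> Hom A I X" and w: "w \<in> Hom A W I"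
    and test: "\<And>R q. \<lbrakk>q \<in> Hom A X R; q \<cdot> (i \<cdot> w) = Zero A W R\<rbrakk> \<Longrightarrow> q \<cdot> i = Zero A I R"
  shows "is_epi A w"
proof -
  have zero: "a = Zero A I L" if a: "a \<in> Hom A I L" "a \<cdot> w = Zero A W L" for L a
  proof -
    obtain k where k: "is_kernel A k a" using ex_kernel a by (auto simp: Hom_def)
    then obtain K where kI: "k \<in> Hom A K I" using a by (auto simp: is_kernel_def Hom_def)
    obtain w' where w': "w' \<in> Hom A W K" "k \<cdot> w' = w"
      using kernel_factor[OF k kI a(1) w a(2)] .
    have ik: "i \<cdot> k \<in> Hom A K X" using Comp_closed[OF kI i(2)] .
    obtain q where q: "is_kernel A (i \<cdot> k) q"
      using mono_is_kernel mono_Comp[OF kernel_is_mono[OF k] kI i] by blast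
    obtain R where qX: "q \<in> Hom A X R" using q ik by (auto simp: is_kernel_def Hom_def)
    have "i \<cdot> w = (i \<cdot> k) \<cdot> w'" using Comp_assoc[OF w'(1) kI i(2)] w'(2) by simp
    then have "q \<cdot> (i \<cdot> w) = Zero A W R"
      using Comp_assoc[OF w'(1) ik qX] kernel_Comp[OF q ik qX]
        Zero_Comp[OF w'(1) Hom_Obj(2)[OF qX]] by simp
    then have "q \<cdot> i = Zero A I R" using test qX by blast
    then obtain s where s: "s \<in> Hom A I K" "(i \<cdot> k) \<cdot> s = i"
      using kernel_factor[OF q ik qX i(2)] by blast
    have I: "I \<in> Obj A" "L \<in> Obj A" using Hom_Obj[OF a(1)] .
    have "i \<cdot> (k \<cdot> s) = i \<cdot> Ide A I"
      using Comp_assoc[OF s(1) kI i(2)] s(2) Comp_Ide[OF i(2)] by simp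
    then have "k \<cdot> s = Ide A I"
      using mono_cancel[OF i Comp_closed[OF s(1) kI] Ide_closed[OF I(1)]] by blast
    then have "a = (a \<cdot> k) \<cdot> s"
      using Comp_assoc[OF s(1) kI a(1)] Comp_Ide[OF a(1)] by simp
    then show ?thesis
      using kernel_Comp[OF k kI a(1)] Zero_Comp[OF s(1) I(2)] by simp
  qed
  then show ?thesis using is_epi_if_zero_test[OF w] by simp
qed

text \<open>The third isomorphism theorem in the form in which it makes \<open>*\<close> associative: \<open>X\<close> is the
  preimage in \<open>M\<close> of the subobject \<open>T\<close> of \<open>E\<close>.  It is constructed as the kernel of \<open>b \<cdot> p\<close>.\<close>

lemma short_exact_refine_quotient:
  assumes s: "short_exact A U i M p E" and t: "short_exact A T k E b F"
  shows "\<exists>X c j q. short_exact A U c X q T \<and> short_exact A X j M (b \<cdot> p) F"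
proof -
  have i: "i \<in> Hom A U M" "is_kernel A i p" and p: "p \<in> Hom A M E" "is_cokernel A p i"
    and k: "k \<in> Hom A T E" "is_kernel A k b" and b: "b \<in> Hom A E F" "is_cokernel A b k"
    using s t by (auto simp: short_exact_def)
  have bp: "b \<cdot> p \<in> Hom A M F" using Comp_closed[OF p(1) b(1)] .
  have bpe: "is_epi A (b \<cdot> p)"
    using epi_Comp[OF cokernel_is_epi[OF p(2)] p(1) cokernel_is_epi[OF b(2)] b(1)] .
  obtain j where j: "is_kernel A j (b \<cdot> p)" using ex_kernel bp by (auto simp: Hom_def)
  then obtain X where jM: "j \<in> Hom A X M" using bp by (auto simp: is_kernel_def Hom_def)
  have jx: "short_exact A X j M (b \<cdot> p) F" using short_exact_kernel[OF bp bpe jM j] .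
  have Ob: "U \<in> Obj A" "X \<in> Obj A" "F \<in> Obj A" using Hom_Obj(1)[OF i(1)] Hom_Obj(1)[OF jM] Hom_Obj(2)[OF b(1)] .
  have pj: "p \<cdot> j \<in> Hom A X E" using Comp_closed[OF jM p(1)] .
  have "b \<cdot> (p \<cdot> j) = Zero A X F"
    using Comp_assoc[OF jM p(1) b(1)] kernel_Comp[OF j jM bp] by simp
  then obtain q where q: "q \<in> Hom A X T" "k \<cdot> q = p \<cdot> j"
    using kernel_factor[OF k(2,1) b(1) pj] by blast
  have pi0: "p \<cdot> i = Zero A U E" using kernel_Comp[OF i(2,1) p(1)] .
  have "(b \<cdot> p) \<cdot> i = Zero A U F"
    using Comp_assoc[OF i(1) p(1) b(1)] pi0 Comp_Zero[OF b(1) Ob(1)] by simp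
  then obtain c where c: "c \<in> Hom A U X" "j \<cdot> c = i"
    using kernel_factor[OF j jM bp i(1)] by blast
  have qc: "q \<cdot> c \<in> Hom A U T" using Comp_closed[OF c(1) q(1)] .
  have T: "T \<in> Obj A" "E \<in> Obj A" using Hom_Obj[OF k(1)] .
  have "k \<cdot> (q \<cdot> c) = p \<cdot> (j \<cdot> c)"
    using Comp_assoc[OF c(1) q(1) k(1)] Comp_assoc[OF c(1) jM p(1)] q(2) by simp
  then have "k \<cdot> (q \<cdot> c) = k \<cdot> Zero A U T"
    using c(2) pi0 Comp_Zero[OF k(1) Ob(1)] by simp
  then have qc0: "q \<cdot> c = Zero A U T"
    using kernel_cancel[OF k(2,1) qc Zero_closed[OF Ob(1) T(1)]] by blast
  have ck: "is_kernel A c q"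
  proof (rule is_kernelI[OF c(1) q(1) qc0])
    fix W u assume u: "u \<in> Hom A W X" "q \<cdot> u = Zero A W T"
    have "p \<cdot> (j \<cdot> u) = k \<cdot> (q \<cdot> u)"
      using Comp_assoc[OF u(1) q(1) k(1)] Comp_assoc[OF u(1) jM p(1)] q(2) by simp
    then have "p \<cdot> (j \<cdot> u) = Zero A W E"
      using u(2) Comp_Zero[OF k(1) Hom_Obj(1)[OF u(1)]] by simp
    then obtain v where v: "v \<in> Hom A W U" "i \<cdot> v = j \<cdot> u"
      using kernel_factor[OF i(2,1) p(1) Comp_closed[OF u(1) jM]] by blast
    then have "j \<cdot> (c \<cdot> v) = j \<cdot> u"
      using Comp_assoc[OF v(1) c(1) jM] c(2) by simp
    then have "c \<cdot> v = u"
      using kernel_cancel[OF j jM Comp_closed[OF v(1) c(1)] u(1)] by blast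
    then show "\<exists>v \<in> Hom A W U. c \<cdot> v = u" by (rule bexI[OF _ v(1)])
  next
    fix W v v' assume v: "v \<in> Hom A W U" "v' \<in> Hom A W U" "c \<cdot> v = c \<cdot> v'"
    have "i \<cdot> v = i \<cdot> v'"
      using Comp_assoc[OF v(1) c(1) jM] Comp_assoc[OF v(2) c(1) jM] c(2) v(3) by simp
    then show "v = v'" using kernel_cancel[OF i(2,1) v(1,2)] by blast
  qed
  \<comment> \<open>A morphism \<open>r\<close> on \<open>E\<close> that kills the image of \<open>X\<close> in \<open>E\<close> factors through \<open>b\<close>, as \<open>r \<cdot> p\<close>
    kills \<open>j = ker (b \<cdot> p)\<close> and \<open>p\<close> can be cancelled; hence it kills \<open>T = ker b\<close>.\<close>
  have "is_epi A q"
  proof (rule epi_onto_subobject[OF kernel_is_mono[OF k(2)] k(1) q(1)])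
    fix R r assume r: "r \<in> Hom A E R" "r \<cdot> (k \<cdot> q) = Zero A X R"
    have "(r \<cdot> p) \<cdot> j = Zero A X R"
      using Comp_assoc[OF jM p(1) r(1)] q(2) r(2) by simp
    then obtain s where s: "s \<in> Hom A F R" "s \<cdot> (b \<cdot> p) = r \<cdot> p"
      using cokernel_factor[of "b \<cdot> p" j, OF _ bp jM Comp_closed[OF p(1) r(1)]] jx
      by (auto simp: short_exact_def)
    then have "(s \<cdot> b) \<cdot> p = r \<cdot> p" using Comp_assoc[OF p(1) b(1) s(1)] by simp
    then have "s \<cdot> b = r"
      using cokernel_cancel[OF p(2,1) Comp_closed[OF b(1) s(1)] r(1)] by blast
    then have "r \<cdot> k = s \<cdot> (b \<cdot> k)" using Comp_assoc[OF k(1) b(1) s(1)] by simp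
    then show "r \<cdot> k = Zero A T R"
      using kernel_Comp[OF k(2,1) b(1)] Comp_Zero[OF s(1) T(1)] by simp
  qed
  then have "short_exact A U c X q T" using short_exact_kernel[OF q(1) _ c(1) ck] by blast
  with jx show ?thesis by blast
qed

lemma ext_star_assoc1:
  "ext_star A U (ext_star A V W) \<subseteq> ext_star A (ext_star A U V) W"
proof
  fix M assume "M \<in> ext_star A U (ext_star A V W)"
  then obtain X E Y Z f g h l where M: "M \<in> Obj A" and
    s: "X \<in> U" "short_exact A X f M g E" "Y \<in> V" "Z \<in> W" "short_exact A Y h E l Z"
    by (auto simp: ext_star_def)
  then obtain N c j q where n: "short_exact A X c N q Y" "short_exact A N j M (l \<cdot> g) Z"
    using short_exact_refine_quotient[OF s(2,5)] by auto
  show "M \<in> ext_star A (ext_star A U V) W"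
    using ext_starI[OF n(2) ext_starI[OF n(1) s(1,3)] s(4)] .
qed

lemma ext_star_assoc2:
  "ext_star A (ext_star A U V) W \<subseteq> ext_star A U (ext_star A V W)"
  using abelian_category.ext_star_assoc1[OF opp, of W V U] by simp

text \<open>The object \<open>I = ker (coker h)\<close> is the image of \<open>h\<close>.\<close>

lemma image_epi:
  assumes h: "h \<in> Hom A W X" and e: "is_cokernel A e h" "e \<in> Hom A X E"
    and i: "is_kernel A i e" "i \<in> Hom A I X" and w: "w \<in> Hom A W I" "i \<cdot> w = h"
  shows "is_epi A w"
proof (rule epi_onto_subobject[OF kernel_is_mono[OF i(1)] i(2) w(1)])
  fix R q assume q: "q \<in> Hom A X R" "q \<cdot> (i \<cdot> w) = Zero A W R"
  then obtain r where r: "r \<in> Hom A E R" "r \<cdot> e = q"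
    using cokernel_factor[OF e h] w(2) by blast
  then have "q \<cdot> i = r \<cdot> (e \<cdot> i)" using Comp_assoc[OF i(2) e(2) r(1)] by simp
  then show "q \<cdot> i = Zero A I R"
    using kernel_Comp[OF i e(2)] Comp_Zero[OF r(1) Hom_Obj(1)[OF i(2)]] by simp
qed

text \<open>The pullback \<open>P\<close> is the kernel of the difference map \<open>X \<oplus> Y \<rightarrow> Z\<close>.  That map is epi because
  \<open>f\<close> is, so it is also the cokernel of \<open>P \<rightarrow> X \<oplus> Y\<close>, and this exactness makes \<open>q\<close> epi.
  The kernel of \<open>q\<close> is again \<open>K\<close>, which is what keeps \<open>P\<close> inside an extension-closed class.\<close>

lemma ex_pullback_of_epi:
  assumes f: "f \<in> Hom A X Z" "is_epi A f" and k: "k \<in> Hom A K X" "is_kernel A k f"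
    and g: "g \<in> Hom A Y Z"
  shows "\<exists>P p q l. p \<in> Hom A P X \<and> is_pullback A p q f g \<and> short_exact A K l P q Y \<and> p \<cdot> l = k"
proof -
  have Ob: "K \<in> Obj A" "X \<in> Obj A" "Y \<in> Obj A" "Z \<in> Obj A"
    using Hom_Obj[OF k(1)] Hom_Obj[OF g] by simp_all
  obtain B i j r s where b: "is_biproduct A X Y B i j r s"
    using ex_biproduct[OF Ob(2,3)] by auto
  have t: "i \<in> Hom A X B" "j \<in> Hom A Y B" "r \<in> Hom A B X" "s \<in> Hom A B Y"
    "r \<cdot> i = Ide A X" "s \<cdot> j = Ide A Y" "s \<cdot> i = Zero A X Y"
    using b by (auto simp: is_biproduct_def)
  obtain g' where g': "g' \<in> Hom A Y Z" "Add A g g' = Zero A Y Z"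
    using ex_negative[OF g] by auto
  define m where "m = Add A (f \<cdot> r) (g' \<cdot> s)"
  have fr: "f \<cdot> r \<in> Hom A B Z" and gs: "g' \<cdot> s \<in> Hom A B Z"
    using Comp_closed[OF t(3) f(1)] Comp_closed[OF t(4) g'(1)] .
  have m: "m \<in> Hom A B Z" unfolding m_def by (rule Add_closed[OF fr gs])
  have mw: "m \<cdot> w = Add A (f \<cdot> (r \<cdot> w)) (g' \<cdot> (s \<cdot> w))" if "w \<in> Hom A W B" for W w
    unfolding m_def using Add_Comp[OF that fr gs] Comp_assoc[OF that t(3) f(1)]
      Comp_assoc[OF that t(4) g'(1)] by simp
  \<comment> \<open>\<open>m\<close> is \<open>f r - g s\<close>, so that its kernel classifies the pairs that agree in \<open>Z\<close>.\<close>
  have m0: "m \<cdot> w = Zero A W Z \<longleftrightarrow> f \<cdot> (r \<cdot> w) = g \<cdot> (s \<cdot> w)" if w: "w \<in> Hom A W B" for W w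
  proof -
    have rw: "r \<cdot> w \<in> Hom A W X" and sw: "s \<cdot> w \<in> Hom A W Y"
      using Comp_closed[OF w t(3)] Comp_closed[OF w t(4)] .
    have "Add A (g \<cdot> (s \<cdot> w)) (g' \<cdot> (s \<cdot> w)) = Zero A W Z"
      using Add_Comp[OF sw g g'(1)] g'(2) Zero_Comp[OF sw Ob(4)] by simp
    then show ?thesis
      using Add_right_cancel[OF Comp_closed[OF rw f(1)] Comp_closed[OF sw g] Comp_closed[OF sw g'(1)]]
        mw[OF w] by simp
  qed
  have mi: "m \<cdot> i = f"
    using mw[OF t(1)] t(5,7) Comp_Ide[OF f(1)] Comp_Zero[OF g'(1) Ob(2)] Add_Zero_right[OF f(1)]
    by simp
  have me: "is_epi A m"
  proof (rule is_epiI[OF m])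
    fix W v v' assume v: "v \<in> Hom A Z W" "v' \<in> Hom A Z W" "v \<cdot> m = v' \<cdot> m"
    have "x \<cdot> f = (x \<cdot> m) \<cdot> i" if "x \<in> Hom A Z W" for x
      using Comp_assoc[OF t(1) m that] mi by simp
    from this[OF v(1)] this[OF v(2)] have "v \<cdot> f = v' \<cdot> f" by (simp only: v(3))
    then show "v = v'" using epi_cancel[OF f(2,1) v(1,2)] by simp
  qed
  obtain n where nk: "is_kernel A n m" using ex_kernel m by (auto simp: Hom_def)
  then obtain P where n: "n \<in> Hom A P B" using m by (auto simp: is_kernel_def Hom_def)
  have mn: "is_cokernel A m n" using epi_is_cokernel_of_kernel[OF me nk] .
  have P: "P \<in> Obj A" using Hom_Obj[OF n] by simp
  define p where "p = r \<cdot> n"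
  define q where "q = s \<cdot> n"
  have p: "p \<in> Hom A P X" and q: "q \<in> Hom A P Y"
    unfolding p_def q_def using Comp_closed[OF n t(3)] Comp_closed[OF n t(4)] .
  have pb: "is_pullback A p q f g"
  proof (rule is_pullbackI[OF p q f(1) g])
    show "f \<cdot> p = g \<cdot> q"
      using m0[OF n] kernel_Comp[OF nk n m] by (simp add: p_def q_def)
  next
    fix W u v assume u: "u \<in> Hom A W X" "v \<in> Hom A W Y" "f \<cdot> u = g \<cdot> v"
    obtain w where w: "w \<in> Hom A W B" "r \<cdot> w = u" "s \<cdot> w = v"
      using biproduct_factor[OF b u(1,2)] .
    have "m \<cdot> w = Zero A W Z" using m0[OF w(1)] w(2,3) u(3) by simp
    then obtain x where x: "x \<in> Hom A W P" "n \<cdot> x = w"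
      using kernel_factor[OF nk n m w(1)] by auto
    have "p \<cdot> x = u" "q \<cdot> x = v"
      unfolding p_def q_def
      using Comp_assoc[OF x(1) n t(3)] Comp_assoc[OF x(1) n t(4)] x(2) w(2,3) by simp_all
    with x(1) show "\<exists>w. w \<in> Hom A W P \<and> p \<cdot> w = u \<and> q \<cdot> w = v" by auto
  next
    fix W w w' assume w: "w \<in> Hom A W P" "w' \<in> Hom A W P" "p \<cdot> w = p \<cdot> w'" "q \<cdot> w = q \<cdot> w'"
    have "r \<cdot> (n \<cdot> x) = p \<cdot> x" "s \<cdot> (n \<cdot> x) = q \<cdot> x" if "x \<in> Hom A W P" for x
      using Comp_assoc[OF that n t(3)] Comp_assoc[OF that n t(4)] by (simp_all add: p_def q_def)
    from this[OF w(1)] this[OF w(2)]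
    have "r \<cdot> (n \<cdot> w) = r \<cdot> (n \<cdot> w')" "s \<cdot> (n \<cdot> w) = s \<cdot> (n \<cdot> w')"
      by (simp_all only: w(3,4))
    then have "n \<cdot> w = n \<cdot> w'"
      using biproduct_cancel[OF b Comp_closed[OF w(1) n] Comp_closed[OF w(2) n]] by simp
    then show "w = w'" using kernel_cancel[OF nk n w(1,2)] by simp
  qed
  \<comment> \<open>If \<open>a \<cdot> q = 0\<close>, then \<open>a \<cdot> s\<close> factors through \<open>m\<close> by some \<open>c\<close>; restricting to the summand
    \<open>X\<close>, where \<open>s\<close> vanishes and \<open>m\<close> is the epimorphism \<open>f\<close>, shows \<open>c = 0\<close>.\<close>
  have qe: "is_epi A q"
  proof (rule is_epi_if_zero_test[OF q])
    fix W a assume a: "a \<in> Hom A Y W" "a \<cdot> q = Zero A P W"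
    have as: "a \<cdot> s \<in> Hom A B W" using Comp_closed[OF t(4) a(1)] .
    have W: "W \<in> Obj A" using Hom_Obj[OF a(1)] by simp
    have "(a \<cdot> s) \<cdot> n = Zero A P W"
      using Comp_assoc[OF n t(4) a(1)] a(2) by (simp add: q_def)
    then obtain c where c: "c \<in> Hom A Z W" "c \<cdot> m = a \<cdot> s"
      using cokernel_factor[OF mn m n as] by auto
    have "c \<cdot> f = (a \<cdot> s) \<cdot> i"
      using Comp_assoc[OF t(1) m c(1)] mi c(2) by simp
    then have "c \<cdot> f = Zero A Z W \<cdot> f"
      using Comp_assoc[OF t(1,4) a(1)] t(7) Comp_Zero[OF a(1) Ob(2)] Zero_Comp[OF f(1) W] by simp
    then have "c = Zero A Z W"
      using epi_cancel[OF f(2,1) c(1) Zero_closed[OF Ob(4) W]] by simp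
    then have "a \<cdot> s = Zero A B W" using c(2) Zero_Comp[OF m W] by simp
    then have "a \<cdot> (s \<cdot> j) = Zero A Y W"
      using Comp_assoc[OF t(2,4) a(1)] Zero_Comp[OF t(2) W] by simp
    then show "a = Zero A Y W" using t(6) Comp_Ide[OF a(1)] by simp
  qed
  have "f \<cdot> k = g \<cdot> Zero A K Y"
    using kernel_Comp[OF k(2,1) f(1)] Comp_Zero[OF g Ob(1)] by simp
  then obtain l where l: "l \<in> Hom A K P" "p \<cdot> l = k" "q \<cdot> l = Zero A K Y"
    using pullback_factor[OF pb p f(1) g k(1) Zero_closed[OF Ob(1,3)]] by auto
  have "is_kernel A l q"
  proof (rule is_kernelI[OF l(1) q l(3)])
    fix W u assume u: "u \<in> Hom A W P" "q \<cdot> u = Zero A W Y"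
    have W: "W \<in> Obj A" using Hom_Obj[OF u(1)] by simp
    have "f \<cdot> (p \<cdot> u) = g \<cdot> (q \<cdot> u)"
      using Comp_assoc[OF u(1) p f(1)] Comp_assoc[OF u(1) q g] pb by (simp add: is_pullback_def)
    then have "f \<cdot> (p \<cdot> u) = Zero A W Z" using u(2) Comp_Zero[OF g W] by simp
    then obtain v where v: "v \<in> Hom A W K" "k \<cdot> v = p \<cdot> u"
      using kernel_factor[OF k(2,1) f(1) Comp_closed[OF u(1) p]] by auto
    have "p \<cdot> (l \<cdot> v) = p \<cdot> u" "q \<cdot> (l \<cdot> v) = q \<cdot> u"
      using Comp_assoc[OF v(1) l(1) p] Comp_assoc[OF v(1) l(1) q] l(2,3) v(2) u(2)
        Zero_Comp[OF v(1) Ob(3)] by simp_all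
    then have "l \<cdot> v = u"
      using pullback_cancel[OF pb p q Comp_closed[OF v(1) l(1)] u(1)] by simp
    then show "\<exists>v \<in> Hom A W K. l \<cdot> v = u" by (rule bexI[OF _ v(1)])
  next
    fix W v v' assume v: "v \<in> Hom A W K" "v' \<in> Hom A W K" "l \<cdot> v = l \<cdot> v'"
    have "k \<cdot> x = p \<cdot> (l \<cdot> x)" if "x \<in> Hom A W K" for x
      using Comp_assoc[OF that l(1) p] l(2) by simp
    from this[OF v(1)] this[OF v(2)] have "k \<cdot> v = k \<cdot> v'" by (simp only: v(3))
    then show "v = v'" using kernel_cancel[OF k(2,1) v(1,2)] by simp
  qed
  then have "short_exact A K l P q Y" using short_exact_kernel[OF q qe l(1)] by simp
  with p pb l(2) show ?thesis by auto
qed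

end

section \<open>Torsion pairs and orthogonality\<close>

text \<open>An inclusion, and not an equation, because \<open>Hom A X Y\<close> is empty unless \<open>X\<close> and \<open>Y\<close> are
  objects; the relation then makes sense for arbitrary sets.\<close>

definition hom_orthogonal :: "('o, 'm) precat \<Rightarrow> 'o set \<Rightarrow> 'o set \<Rightarrow> bool" where
  "hom_orthogonal A U V \<longleftrightarrow> (\<forall>X \<in> U. \<forall>Y \<in> V. Hom A X Y \<subseteq> {Zero A X Y})"

lemma hom_orthogonal_opp [simp]: "hom_orthogonal (opp A) V U \<longleftrightarrow> hom_orthogonal A U V"
  by (auto simp: hom_orthogonal_def)

lemma hom_orthogonalD:
  "\<lbrakk>hom_orthogonal A U V; f \<in> Hom A X Y; X \<in> U; Y \<in> V\<rbrakk> \<Longrightarrow> f = Zero A X Y"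
  by (auto simp: hom_orthogonal_def)

lemma hom_orthogonalI:
  "(\<And>X Y f. \<lbrakk>X \<in> U; Y \<in> V; f \<in> Hom A X Y\<rbrakk> \<Longrightarrow> f = Zero A X Y) \<Longrightarrow> hom_orthogonal A U V"
  by (auto simp: hom_orthogonal_def)

lemma hom_orthogonal_mono:
  "\<lbrakk>hom_orthogonal A U V; U' \<subseteq> U; V' \<subseteq> V\<rbrakk> \<Longrightarrow> hom_orthogonal A U' V'"
  by (auto simp: hom_orthogonal_def)

lemma torsion_pair_orthogonal: "torsion_pair A T F \<Longrightarrow> hom_orthogonal A T F"
  by (auto simp: torsion_pair_def hom_orthogonal_def)

lemma torsion_pair_short_exact:
  assumes "torsion_pair A T F" "M \<in> Obj A"
  obtains X Y f g where "X \<in> T" "Y \<in> F" "short_exact A X f M g Y"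
  using assms unfolding torsion_pair_def by meson

lemma torsion_pair_Obj: "torsion_pair A T F \<Longrightarrow> T \<subseteq> Obj A \<and> F \<subseteq> Obj A"
  by (simp add: torsion_pair_def)

context preadditive_category begin

lemma torsion_pairI:
  assumes "T \<subseteq> Obj A" "F \<subseteq> Obj A" "iso_closed A T" "iso_closed A F" "hom_orthogonal A T F"
    and "\<And>M. M \<in> Obj A \<Longrightarrow> \<exists>X \<in> T. \<exists>Y \<in> F. \<exists>f g. short_exact A X f M g Y"
  shows "torsion_pair A T F"
proof -
  have "Hom A X Y = {Zero A X Y}" if "X \<in> T" "Y \<in> F" for X Y
  proof
    show "Hom A X Y \<subseteq> {Zero A X Y}" using that assms(5) by (simp add: hom_orthogonal_def)
    have "X \<in> Obj A" "Y \<in> Obj A" using that assms(1,2) by auto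
    then show "{Zero A X Y} \<subseteq> Hom A X Y" using Zero_closed by simp
  qed
  with assms show ?thesis by (simp add: torsion_pair_def)
qed

lemma hom_orthogonal_ext_star:
  assumes U: "hom_orthogonal A U W" and V: "hom_orthogonal A V W"
  shows "hom_orthogonal A (ext_star A U V) W"
proof (rule hom_orthogonalI)
  fix M Y a assume "M \<in> ext_star A U V" and Y: "Y \<in> W" and a: "a \<in> Hom A M Y"
  then obtain X Z f g where s: "X \<in> U" "Z \<in> V" "short_exact A X f M g Z"
    by (auto simp: ext_star_def)
  have f: "f \<in> Hom A X M" and g: "g \<in> Hom A M Z" "is_cokernel A g f"
    using s(3) by (auto simp: short_exact_def)
  have "a \<cdot> f = Zero A X Y" using hom_orthogonalD[OF U Comp_closed[OF f a] s(1) Y] .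
  then obtain v where v: "v \<in> Hom A Z Y" "v \<cdot> g = a"
    using cokernel_factor[OF g(2,1) f a] by auto
  then show "a = Zero A M Y"
    using hom_orthogonalD[OF V v(1) s(2) Y] Zero_Comp[OF g(1) Hom_Obj(2)[OF a]] by simp
qed

lemma hom_orthogonal_ext_star_right:
  "\<lbrakk>hom_orthogonal A W U; hom_orthogonal A W V\<rbrakk> \<Longrightarrow> hom_orthogonal A W (ext_star A U V)"
  using preadditive_category.hom_orthogonal_ext_star[OF opp_preadditive, of V W U] by simp

text \<open>If \<open>M\<close> is orthogonal to \<open>F\<close>, then the torsionfree quotient map of \<open>M\<close> vanishes, and its
  kernel, the torsion part, is all of \<open>M\<close>.  Since only a kernel and no abelian structure is involved,
  this also applies to torsion pairs in \<open>C' \<inter> D\<close>.\<close>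

lemma mem_torsion_class:
  assumes tp: "torsion_pair A T F" and M: "M \<in> Obj A" and orth: "hom_orthogonal A {M} F"
  shows "M \<in> T"
proof -
  obtain X Y f g where s: "X \<in> T" "Y \<in> F" "short_exact A X f M g Y"
    using torsion_pair_short_exact[OF tp M] .
  have f: "f \<in> Hom A X M" "is_kernel A f g" and g: "g \<in> Hom A M Y"
    using s(3) by (auto simp: short_exact_def)
  have X: "X \<in> Obj A" using Hom_Obj[OF f(1)] by simp
  have "g = Zero A M Y" using hom_orthogonalD[OF orth g _ s(2)] by simp
  then obtain v where v: "v \<in> Hom A M X" "f \<cdot> v = Ide A M"
    using kernel_factor[OF f(2,1) g Ide_closed[OF M]] Comp_Ide[OF g] by auto
  have "f \<cdot> (v \<cdot> f) = f \<cdot> Ide A X"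
    using Comp_assoc[OF f(1) v(1) f(1)] v(2) Ide_Comp[OF f(1)] Comp_Ide[OF f(1)] by simp
  then have "v \<cdot> f = Ide A X"
    using kernel_cancel[OF f(2,1) Comp_closed[OF f(1) v(1)] Ide_closed[OF X]] by simp
  then have "isomorphic A X M"
    using X M f(1) v by (auto simp: isomorphic_def)
  then show ?thesis using tp s(1) by (auto simp: torsion_pair_def iso_closed_def)
qed

lemma mem_torsionfree_class:
  "\<lbrakk>torsion_pair A T F; M \<in> Obj A; hom_orthogonal A T {M}\<rbrakk> \<Longrightarrow> M \<in> F"
  using preadditive_category.mem_torsion_class[OF opp_preadditive, of F T M] by simp

text \<open>The larger \<open>T'\<close> is orthogonal to \<open>F'\<close>, hence to the smaller \<open>F\<close>, hence contained in \<open>T\<close>.\<close>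

lemma torsion_pair_eqI:
  assumes "torsion_pair A T F" "torsion_pair A T' F'" "T \<subseteq> T'" "F \<subseteq> F'"
  shows "T = T' \<and> F = F'"
proof -
  have o: "hom_orthogonal A T' F'" using torsion_pair_orthogonal[OF assms(2)] .
  have "T' \<subseteq> T"
    using mem_torsion_class[OF assms(1)] hom_orthogonal_mono[OF o] assms(4)
      torsion_pair_Obj[OF assms(2)] by blast
  moreover have "F' \<subseteq> F"
    using mem_torsionfree_class[OF assms(1)] hom_orthogonal_mono[OF o] assms(3)
      torsion_pair_Obj[OF assms(2)] by blast
  ultimately show ?thesis using assms(3,4) by blast
qed

lemma torsion_class_extension:
  assumes tp: "torsion_pair A T F"
  shows "ext_star A T T \<subseteq> T"
proof
  fix M assume M: "M \<in> ext_star A T T"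
  have "hom_orthogonal A (ext_star A T T) F"
    using hom_orthogonal_ext_star torsion_pair_orthogonal[OF tp] by simp
  then have "hom_orthogonal A {M} F" using M by (auto intro: hom_orthogonal_mono)
  then show "M \<in> T" using mem_torsion_class[OF tp] M by (simp add: ext_star_def)
qed

lemma torsionfree_class_extension: "torsion_pair A T F \<Longrightarrow> ext_star A F F \<subseteq> F"
  using preadditive_category.torsion_class_extension[OF opp_preadditive, of F T] by simp

lemma torsion_class_quotient:
  assumes tp: "torsion_pair A T F" and e: "e \<in> Hom A M N" "is_epi A e" and M: "M \<in> T"
  shows "N \<in> T"
proof (rule mem_torsion_class[OF tp])
  show N: "N \<in> Obj A" using Hom_Obj[OF e(1)] by simp
  show "hom_orthogonal A {N} F"
  proof (rule hom_orthogonalI)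
    fix X Y a assume "X \<in> {N}" and Y: "Y \<in> F" and "a \<in> Hom A X Y"
    then have a: "a \<in> Hom A N Y" and X: "X = N" by simp_all
    have YO: "Y \<in> Obj A" using Hom_Obj[OF a] by simp
    have "a \<cdot> e = Zero A N Y \<cdot> e"
      using hom_orthogonalD[OF torsion_pair_orthogonal[OF tp] Comp_closed[OF e(1) a] M Y]
        Zero_Comp[OF e(1) YO] by simp
    then show "a = Zero A X Y"
      using epi_cancel[OF e(2,1) a Zero_closed[OF N YO]] X by simp
  qed
qed

lemma torsionfree_class_subobject:
  "\<lbrakk>torsion_pair A T F; m \<in> Hom A M N; is_mono A m; N \<in> F\<rbrakk> \<Longrightarrow> M \<in> F"
  using preadditive_category.torsion_class_quotient[OF opp_preadditive, of F T m N M] by simp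

lemma torsion_class_biproduct:
  assumes tp: "torsion_pair A T F" and b: "is_biproduct A X Y B i j p q" and XY: "X \<in> T" "Y \<in> T"
  shows "B \<in> T"
proof (rule mem_torsion_class[OF tp])
  show B: "B \<in> Obj A" using b by (simp add: is_biproduct_def)
  show "hom_orthogonal A {B} F"
  proof (rule hom_orthogonalI)
    fix B' Z a assume "B' \<in> {B}" and Z: "Z \<in> F" and "a \<in> Hom A B' Z"
    then have a: "a \<in> Hom A B Z" and B': "B' = B" by simp_all
    have ZO: "Z \<in> Obj A" using Hom_Obj[OF a] by simp
    have t: "i \<in> Hom A X B" "j \<in> Hom A Y B" using b by (auto simp: is_biproduct_def)
    note zero = hom_orthogonalD[OF torsion_pair_orthogonal[OF tp] _ _ Z]
    have "a \<cdot> i = Zero A B Z \<cdot> i" "a \<cdot> j = Zero A B Z \<cdot> j"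
      using zero[OF Comp_closed[OF t(1) a] XY(1)] zero[OF Comp_closed[OF t(2) a] XY(2)]
        Zero_Comp[OF t(1) ZO] Zero_Comp[OF t(2) ZO] by simp_all
    then show "a = Zero A B' Z"
      using preadditive_category.biproduct_cancel[OF opp_preadditive, of X Y B p q i j a Z "Zero A B Z"]
        b a Zero_closed[OF B ZO] B' by simp
  qed
qed

lemma torsionfree_class_biproduct:
  "\<lbrakk>torsion_pair A T F; is_biproduct A X Y B i j p q; X \<in> F; Y \<in> F\<rbrakk> \<Longrightarrow> B \<in> F"
  using preadditive_category.torsion_class_biproduct[OF opp_preadditive, of F T X Y B p q i j] by simp

lemma torsion_class_zero_object:
  assumes tp: "torsion_pair A T F" and N: "is_zero_object A N"
  shows "N \<in> T"
proof (rule mem_torsion_class[OF tp])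
  show N': "N \<in> Obj A" using N by (simp add: is_zero_object_def)
  show "hom_orthogonal A {N} F"
  proof (rule hom_orthogonalI)
    fix X Y f assume "X \<in> {N}" and Y: "Y \<in> F" and f: "f \<in> Hom A X Y"
    then have "Y \<in> Obj A" and X: "X = N" using Hom_Obj[OF f] by simp_all
    then have "\<exists>!f. f \<in> Hom A N Y" using N by (simp add: is_zero_object_def)
    then show "f = Zero A X Y" using f Zero_closed[OF N' \<open>Y \<in> Obj A\<close>] X by auto
  qed
qed

lemma torsionfree_class_zero_object: "\<lbrakk>torsion_pair A T F; is_zero_object A N\<rbrakk> \<Longrightarrow> N \<in> F"
  using preadditive_category.torsion_class_zero_object[OF opp_preadditive, of F T N] by simp

end

section \<open>Full subcategories\<close>

lemma full_subcat_simps [simp]: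
  "Obj (full_subcat A S) = Obj A \<inter> S" "Dom (full_subcat A S) = Dom A"
  "Cod (full_subcat A S) = Cod A" "Ide (full_subcat A S) = Ide A"
  "g \<cdot>\<^bsub>full_subcat A S\<^esub> f = g \<cdot>\<^bsub>A\<^esub> f" "Add (full_subcat A S) = Add A"
  "Zero (full_subcat A S) = Zero A"
  by (simp_all add: full_subcat_def)

lemma Hom_full_subcat:
  "Hom (full_subcat A S) X Y = (if X \<in> S \<and> Y \<in> S then Hom A X Y else {})"
  by (auto simp: full_subcat_def Hom_def)

lemma Hom_full_subcat_iff [simp]:
  "f \<in> Hom (full_subcat A S) X Y \<longleftrightarrow> f \<in> Hom A X Y \<and> X \<in> S \<and> Y \<in> S"
  by (simp add: Hom_full_subcat)

lemma Arr_full_subcat [simp]: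
  "f \<in> Arr (full_subcat A S) \<longleftrightarrow> f \<in> Arr A \<and> Dom A f \<in> S \<and> Cod A f \<in> S"
  by (simp add: full_subcat_def)

lemma is_kernel_full_subcat:
  assumes "is_kernel A k f" "Dom A k \<in> S" "Dom A f \<in> S" "Cod A f \<in> S"
  shows "is_kernel (full_subcat A S) k f"
  using assms unfolding is_kernel_def by simp

lemma is_cokernel_full_subcat:
  assumes "is_cokernel A c f" "Cod A c \<in> S" "Dom A f \<in> S" "Cod A f \<in> S"
  shows "is_cokernel (full_subcat A S) c f"
  using is_kernel_full_subcat[of "opp A" c f S] assms by simp

lemma short_exact_full_subcat:
  assumes "short_exact A X f M g Y" "X \<in> S" "M \<in> S" "Y \<in> S"
  shows "short_exact (full_subcat A S) X f M g Y"
proof -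
  have "Dom A f = X" "Dom A g = M" "Cod A f = M" "Cod A g = Y"
    using assms(1) by (auto simp: short_exact_def Hom_def)
  with assms show ?thesis
    by (simp add: short_exact_def is_kernel_full_subcat is_cokernel_full_subcat)
qed

lemma is_biproduct_full_subcat:
  "is_biproduct A X Y B i j p q \<Longrightarrow> X \<in> S \<Longrightarrow> Y \<in> S \<Longrightarrow> B \<in> S
    \<Longrightarrow> is_biproduct (full_subcat A S) X Y B i j p q"
  by (simp add: is_biproduct_def)

lemma is_zero_object_full_subcat:
  assumes "is_zero_object A N" "N \<in> S" shows "is_zero_object (full_subcat A S) N"
  using assms unfolding is_zero_object_def by (simp add: Hom_full_subcat)

lemma (in category) category_full_subcat: "category (full_subcat A S)"
  by unfold_locales
    (auto simp: Dom_closed Cod_closed Ide_closed Comp_Ide Ide_Comp Comp_assoc intro: Comp_closed)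

lemma (in preadditive_category) preadditive_full_subcat:
  "preadditive_category (full_subcat A S)"
proof -
  have *: "hom_group (full_subcat A S) X Y = hom_group A X Y" if "X \<in> S" "Y \<in> S" for X Y
    using that by (simp add: hom_group_def Hom_full_subcat)
  show ?thesis
    by (intro preadditive_category.intro category_full_subcat preadditive_category_axioms.intro)
      (auto simp: * Hom_comm_group intro: Comp_Add Add_Comp)
qed

lemma isomorphic_full_subcat:
  "isomorphic (full_subcat A S) X Y \<Longrightarrow> isomorphic A X Y \<and> Y \<in> S"
  unfolding isomorphic_def by (simp add: Bex_def) blast

lemma iso_closed_full_subcat:
  assumes "iso_closed A T" "S \<subseteq> T'" shows "iso_closed (full_subcat A S) (T \<inter> T')"
  unfolding iso_closed_def
proof (intro ballI allI impI)
  fix X Y assume "X \<in> T \<inter> T'" "isomorphic (full_subcat A S) X Y"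
  then have X: "X \<in> T" and i: "isomorphic A X Y" and Y: "Y \<in> S"
    using isomorphic_full_subcat[of A S X Y] by simp_all
  have "Y \<in> T" using assms(1)[unfolded iso_closed_def, rule_format, OF X i] .
  then show "Y \<in> T \<inter> T'" using Y assms(2) by auto
qed

section \<open>The heart of an interval of torsion pairs\<close>

locale torsion_interval = abelian_category +
  fixes C D C' D' :: "'a set"
  assumes tp: "torsion_pair A C D" and tp': "torsion_pair A C' D'" and C_le: "C \<subseteq> C'"
begin

abbreviation heart where "heart \<equiv> full_subcat A (C' \<inter> D)"

lemma D'_le: "D' \<subseteq> D"
proof
  fix M assume M: "M \<in> D'"
  show "M \<in> D"
  proof (rule mem_torsionfree_class[OF tp])
    show "M \<in> Obj A" using M torsion_pair_Obj[OF tp'] by auto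
    show "hom_orthogonal A C {M}"
      using hom_orthogonal_mono[OF torsion_pair_orthogonal[OF tp'] C_le] M by simp
  qed
qed

text \<open>All dual statements below are instances of this; the heart is the same set of objects.\<close>

lemma opp_interval: "torsion_interval (opp A) D' C' D C"
  by (intro torsion_interval.intro opp torsion_interval_axioms.intro) (simp_all add: tp tp' D'_le)

lemma preadditive_heart: "preadditive_category heart"
  by (rule preadditive_full_subcat)

lemma additive_heart: "additive_category heart"
proof (intro additive_category.intro preadditive_heart additive_category_axioms.intro)
  obtain N where "is_zero_object A N" using ex_zero_object by auto
  then show "\<exists>N. is_zero_object heart N"
    using is_zero_object_full_subcat[of A N "C' \<inter> D"] torsion_class_zero_object[OF tp']
      torsionfree_class_zero_object[OF tp] by auto
next
  fix X Y assume "X \<in> Obj heart" "Y \<in> Obj heart"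
  then have XY: "X \<in> C'" "X \<in> D" "Y \<in> C'" "Y \<in> D" "X \<in> Obj A" "Y \<in> Obj A" by simp_all
  then obtain B i j p q where b: "is_biproduct A X Y B i j p q" using ex_biproduct by meson
  have "B \<in> C'" "B \<in> D"
    using torsion_class_biproduct[OF tp' b] torsionfree_class_biproduct[OF tp b] XY by simp_all
  then have "is_biproduct heart X Y B i j p q"
    using is_biproduct_full_subcat[OF b, of "C' \<inter> D"] XY by simp
  then show "\<exists>B i j p q. is_biproduct heart X Y B i j p q" by blast
qed

text \<open>The kernel in the heart is the \<open>C'\<close>-torsion part \<open>N\<close> of the kernel \<open>K\<close> in \<open>A\<close>: a morphism
  into \<open>K\<close> from an object of \<open>C'\<close> vanishes on the quotient \<open>Q\<close> of \<open>K\<close> by \<open>N\<close>, which is in \<open>D'\<close>.\<close>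

lemma ex_kernel_heart:
  assumes "f \<in> Arr heart" shows "\<exists>k. is_kernel heart k f"
proof -
  define X Y where "X = Dom A f" and "Y = Cod A f"
  have f: "f \<in> Hom A X Y" and X: "X \<in> C'" "X \<in> D" and Y: "Y \<in> C'" "Y \<in> D"
    using assms by (simp_all add: X_def Y_def Hom_def)
  obtain k where k: "is_kernel A k f" using ex_kernel f by (auto simp: Hom_def)
  then obtain K where kX: "k \<in> Hom A K X" using f by (auto simp: is_kernel_def Hom_def)
  obtain N Q t s where s: "N \<in> C'" "Q \<in> D'" "short_exact A N t K s Q"
    using torsion_pair_short_exact[OF tp' Hom_Obj(1)[OF kX]] .
  have t: "t \<in> Hom A N K" "is_kernel A t s" and sK: "s \<in> Hom A K Q"
    using s(3) by (auto simp: short_exact_def)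
  have kt: "k \<cdot> t \<in> Hom A N X" using Comp_closed[OF t(1) kX] .
  have mono: "is_mono A (k \<cdot> t)"
    using mono_Comp[OF kernel_is_mono[OF t(2)] t(1) kernel_is_mono[OF k] kX] .
  have N: "N \<in> D" using torsionfree_class_subobject[OF tp kt mono X(2)] .
  have "is_kernel heart (k \<cdot> t) f"
  proof (rule preadditive_category.is_kernelI[OF preadditive_heart, of _ N X _ Y])
    show "k \<cdot> t \<in> Hom heart N X" "f \<in> Hom heart X Y"
      using kt f X Y s(1) N by simp_all
    show "f \<cdot>\<^bsub>heart\<^esub> (k \<cdot> t) = Zero heart N Y"
      using Comp_assoc[OF t(1) kX f] kernel_Comp[OF k kX f] Zero_Comp[OF t(1) Hom_Obj(2)[OF f]]
      by simp
  next
    fix W u assume "u \<in> Hom heart W X" "f \<cdot>\<^bsub>heart\<^esub> u = Zero heart W Y"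
    then have u: "u \<in> Hom A W X" "f \<cdot> u = Zero A W Y" and W: "W \<in> C'" "W \<in> D" by simp_all
    obtain v where v: "v \<in> Hom A W K" "k \<cdot> v = u" using kernel_factor[OF k kX f u] .
    have "s \<cdot> v = Zero A W Q"
      using hom_orthogonalD[OF torsion_pair_orthogonal[OF tp'] Comp_closed[OF v(1) sK] W(1) s(2)] .
    then obtain w where w: "w \<in> Hom A W N" "t \<cdot> w = v" using kernel_factor[OF t(2,1) sK v(1)] by auto
    have "(k \<cdot> t) \<cdot> w = u" using Comp_assoc[OF w(1) t(1) kX] w(2) v(2) by simp
    moreover have "w \<in> Hom heart W N" using w(1) W s(1) N by simp
    ultimately show "\<exists>v \<in> Hom heart W N. (k \<cdot> t) \<cdot>\<^bsub>heart\<^esub> v = u" by (auto intro: bexI[of _ w])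
  next
    fix W v v' assume "v \<in> Hom heart W N" "v' \<in> Hom heart W N"
      "(k \<cdot> t) \<cdot>\<^bsub>heart\<^esub> v = (k \<cdot> t) \<cdot>\<^bsub>heart\<^esub> v'"
    then show "v = v'" using mono_cancel[OF mono kt, of v W v'] by simp
  qed
  then show ?thesis by auto
qed

lemma heart_opp: "full_subcat (opp A) (D \<inter> C') = opp heart"
  by (simp add: Int_commute)

lemma ex_cokernel_heart:
  assumes "f \<in> Arr heart" shows "\<exists>c. is_cokernel heart c f"
  using torsion_interval.ex_kernel_heart[OF opp_interval, of f, unfolded heart_opp] assms by simp

lemma pre_abelian_heart: "pre_abelian_category heart"
  by (intro pre_abelian_category.intro additive_heart pre_abelian_category_axioms.intro
      ex_kernel_heart ex_cokernel_heart)

text \<open>Let \<open>f\<close> be the cokernel of \<open>h : W \<rightarrow> X\<close> in the heart, \<open>E\<close> the cokernel of \<open>h\<close> in \<open>A\<close>, and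
  \<open>T \<rightarrow> E \<rightarrow> G\<close> the \<open>(C, D)\<close>-decomposition of \<open>E\<close>.  The composite \<open>X \<rightarrow> E \<rightarrow> G\<close> is an epimorphism
  whose kernel \<open>K\<close> is an extension of \<open>T\<close> by the image \<open>I\<close> of \<open>h\<close>.  As a quotient of \<open>W\<close>, \<open>I\<close> is
  in \<open>C'\<close>, and so is \<open>T \<in> C \<subseteq> C'\<close>; hence \<open>K\<close> is in \<open>C'\<close>.\<close>

lemma cokernel_heart_short_exact:
  assumes c: "is_cokernel heart f h"
  shows "\<exists>K k. K \<in> C' \<inter> D \<and> short_exact A K k (Dom A f) f (Cod A f)"
proof -
  define W X Z where "W = Dom A h" and "X = Dom A f" and "Z = Cod A f"
  have "Cod A h = X" using c by (simp add: is_cokernel_def X_def)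
  then have h: "h \<in> Hom A W X" and f: "f \<in> Hom A X Z"
    and W: "W \<in> C'" "W \<in> D" and X: "X \<in> C'" "X \<in> D" and Z: "Z \<in> C'" "Z \<in> D"
    using c by (auto simp: is_cokernel_def W_def X_def Z_def Hom_def)
  have hH: "h \<in> Hom heart W X" and fH: "f \<in> Hom heart X Z"
    using h f W X Z by simp_all
  interpret H: preadditive_category heart by (rule preadditive_heart)
  obtain e where e: "is_cokernel A e h" using ex_cokernel h by (auto simp: Hom_def)
  then obtain E where eX: "e \<in> Hom A X E" using h by (auto simp: is_cokernel_def Hom_def)
  have ee: "is_epi A e" using cokernel_is_epi[OF e] .
  obtain i where i: "is_kernel A i e" using ex_kernel eX by (auto simp: Hom_def)
  then obtain I where iX: "i \<in> Hom A I X" using eX by (auto simp: is_kernel_def Hom_def)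
  have se: "short_exact A I i X e E" using short_exact_kernel[OF eX ee iX i] .
  obtain w where w: "w \<in> Hom A W I" "i \<cdot> w = h"
    using kernel_factor[OF i iX eX h cokernel_Comp[OF e eX h]] .
  have I: "I \<in> C'"
    using torsion_class_quotient[OF tp' w(1) image_epi[OF h e eX i iX w] W(1)] .
  have EC: "E \<in> C'" using torsion_class_quotient[OF tp' eX ee X(1)] .
  obtain T G t g where s: "T \<in> C" "G \<in> D" "short_exact A T t E g G"
    using torsion_pair_short_exact[OF tp Hom_Obj(2)[OF eX]] .
  have t: "t \<in> Hom A T E" and g: "g \<in> Hom A E G" "is_cokernel A g t"
    using s(3) by (auto simp: short_exact_def)
  have G: "G \<in> C'" using torsion_class_quotient[OF tp' g(1) cokernel_is_epi[OF g(2)] EC] .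
  obtain K d k r where kr: "short_exact A I d K r T" "short_exact A K k X (g \<cdot> e) G"
    using short_exact_refine_quotient[OF se s(3)] by auto
  have k: "k \<in> Hom A K X" "is_kernel A k (g \<cdot> e)" and ge: "g \<cdot> e \<in> Hom A X G" "is_cokernel A (g \<cdot> e) k"
    using kr(2) by (auto simp: short_exact_def)
  have "K \<in> ext_star A C' C'" using ext_starI[OF kr(1) I] s(1) C_le by auto
  then have KC: "K \<in> C'" using torsion_class_extension[OF tp'] by auto
  have KD: "K \<in> D" using torsionfree_class_subobject[OF tp k(1) kernel_is_mono[OF k(2)] X(2)] .
  \<comment> \<open>Both \<open>f\<close> and \<open>g \<cdot> e\<close> are cokernels of \<open>h\<close> in the heart: \<open>a\<close> and \<open>b\<close> compare them.\<close>
  have geH: "g \<cdot> e \<in> Hom heart X G" using ge(1) X G s(2) by simp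
  have "(g \<cdot> e) \<cdot> h = Zero A W G"
    using Comp_assoc[OF h eX g(1)] cokernel_Comp[OF e eX h] Comp_Zero[OF g(1) Hom_Obj(1)[OF h]]
    by simp
  then obtain a where aH: "a \<in> Hom heart Z G" and af: "a \<cdot> f = g \<cdot> e"
    using H.cokernel_factor[OF c fH hH geH] by auto
  have a: "a \<in> Hom A Z G" using aH by simp
  have fh: "f \<cdot> h = Zero A W Z" using H.cokernel_Comp[OF c fH hH] by simp
  obtain b' where b': "b' \<in> Hom A E Z" "b' \<cdot> e = f" using cokernel_factor[OF e eX h f fh] .
  have "b' \<cdot> t = Zero A T Z"
    using hom_orthogonalD[OF torsion_pair_orthogonal[OF tp] Comp_closed[OF t b'(1)] s(1) Z(2)] .
  then obtain b where b: "b \<in> Hom A G Z" "b \<cdot> g = b'" using cokernel_factor[OF g(2,1) t b'(1)] by auto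
  have bge: "b \<cdot> (g \<cdot> e) = f" using Comp_assoc[OF eX g(1) b(1)] b(2) b'(2) by simp
  have ZO: "Z \<in> Obj A" using Hom_Obj[OF f] by simp
  have baH: "b \<cdot> a \<in> Hom heart Z Z" "Ide A Z \<in> Hom heart Z Z"
    using Comp_closed[OF a b(1)] Ide_closed[OF ZO] Z by simp_all
  have "(b \<cdot> a) \<cdot> f = Ide A Z \<cdot> f"
    using Comp_assoc[OF f a b(1)] af bge Ide_Comp[OF f] by simp
  then have ba: "b \<cdot> a = Ide A Z" using H.cokernel_cancel[OF c fH baH] by simp
  have "is_epi A f"
  proof (rule is_epi_if_zero_test[OF f])
    fix L u assume u: "u \<in> Hom A Z L" "u \<cdot> f = Zero A X L"
    have L: "L \<in> Obj A" using Hom_Obj[OF u(1)] by simp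
    have "(u \<cdot> b) \<cdot> (g \<cdot> e) = Zero A G L \<cdot> (g \<cdot> e)"
      using Comp_assoc[OF ge(1) b(1) u(1)] bge u(2) Zero_Comp[OF ge(1) L] by simp
    then have "u \<cdot> b = Zero A G L"
      using cokernel_cancel[OF ge(2,1) Comp_closed[OF b(1) u(1)] Zero_closed[OF Hom_Obj(2)[OF a] L]]
      by simp
    then have "u \<cdot> (b \<cdot> a) = Zero A Z L"
      using Comp_assoc[OF a b(1) u(1)] Zero_Comp[OF a L] by simp
    then show "u = Zero A Z L" using ba Comp_Ide[OF u(1)] by simp
  qed
  moreover have "is_kernel A k f"
  proof (rule is_kernelI[OF k(1) f])
    show "f \<cdot> k = Zero A K Z"
      using Comp_assoc[OF k(1) ge(1) b(1)] bge kernel_Comp[OF k(2,1) ge(1)]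
        Comp_Zero[OF b(1) Hom_Obj(1)[OF k(1)]] by simp
  next
    fix L u assume u: "u \<in> Hom A L X" "f \<cdot> u = Zero A L Z"
    have "(g \<cdot> e) \<cdot> u = Zero A L G"
      using Comp_assoc[OF u(1) f a] af u(2) Comp_Zero[OF a Hom_Obj(1)[OF u(1)]] by simp
    then show "\<exists>v \<in> Hom A L K. k \<cdot> v = u"
      using kernel_factor[OF k(2,1) ge(1) u(1)] by blast
  qed (rule kernel_cancel[OF k(2,1)])
  ultimately have "short_exact A K k X f Z" using short_exact_kernel[OF f _ k(1)] by simp
  then show ?thesis using KC KD by (auto simp: X_def Z_def)
qed

text \<open>By the previous lemma \<open>f\<close> has a kernel in \<open>A\<close> that lies in the heart; it is also a kernel in the
  heart, hence agrees with \<open>k\<close> up to isomorphism.\<close>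

lemma short_exact_heart:
  assumes s: "short_exact heart X k M f Y"
  shows "short_exact A X k M f Y"
proof -
  interpret H: preadditive_category heart by (rule preadditive_heart)
  have kH: "k \<in> Hom heart X M" "is_kernel heart k f" and fH: "f \<in> Hom heart M Y" "is_cokernel heart f k"
    using s by (auto simp: short_exact_def)
  have k: "k \<in> Hom A X M" and f: "f \<in> Hom A M Y" and X: "X \<in> C' \<inter> D" using kH fH by simp_all
  have t: "Dom A f = M" "Cod A f = Y" using f by (auto simp: Hom_def)
  obtain K l where K: "K \<in> C' \<inter> D" "short_exact A K l M f Y"
    using cokernel_heart_short_exact[OF fH(2)] t by auto
  have l: "l \<in> Hom A K M" "is_kernel A l f" and c: "is_cokernel A f l"
    using K(2) by (auto simp: short_exact_def)
  have lH: "l \<in> Hom heart K M" using l(1) K(1) fH(1) by simp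
  have fk: "f \<cdot> k = Zero A X Y" using H.kernel_Comp[OF kH(2,1) fH(1)] by simp
  obtain a where a: "a \<in> Hom A X K" "l \<cdot> a = k" using kernel_factor[OF l(2,1) f k fk] .
  have fl: "f \<cdot>\<^bsub>heart\<^esub> l = Zero heart K Y" using kernel_Comp[OF l(2,1) f] by simp
  obtain b where bH: "b \<in> Hom heart K X" and kb: "k \<cdot> b = l"
    using H.kernel_factor[OF kH(2,1) fH(1) lH fl] by auto
  have b: "b \<in> Hom A K X" using bH by simp
  have ba: "b \<cdot> a = Ide A X"
  proof -
    have "k \<cdot> (b \<cdot> a) = k \<cdot> Ide A X"
      using Comp_assoc[OF a(1) b k] kb a(2) Comp_Ide[OF k] by simp
    then show ?thesis
      using H.kernel_cancel[OF kH(2,1), of "b \<cdot> a" X "Ide A X"] Comp_closed[OF a(1) b] X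
        Ide_closed[OF Hom_Obj(1)[OF k]] by simp
  qed
  have "is_kernel A k f"
  proof (rule is_kernelI[OF k f fk])
    fix W u assume u: "u \<in> Hom A W M" "f \<cdot> u = Zero A W Y"
    obtain v where v: "v \<in> Hom A W K" "l \<cdot> v = u" using kernel_factor[OF l(2,1) f u] .
    have "k \<cdot> (b \<cdot> v) = u" using Comp_assoc[OF v(1) b k] kb v(2) by simp
    then show "\<exists>v \<in> Hom A W X. k \<cdot> v = u" by (rule bexI[OF _ Comp_closed[OF v(1) b]])
  next
    fix W v v' assume v: "v \<in> Hom A W X" "v' \<in> Hom A W X" "k \<cdot> v = k \<cdot> v'"
    have "k \<cdot> x = l \<cdot> (a \<cdot> x)" if "x \<in> Hom A W X" for x
      using Comp_assoc[OF that a(1) l(1)] a(2) by simp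
    from this[OF v(1)] this[OF v(2)] have "l \<cdot> (a \<cdot> v) = l \<cdot> (a \<cdot> v')" by (simp only: v(3))
    then have av: "a \<cdot> v = a \<cdot> v'"
      using kernel_cancel[OF l(2,1) Comp_closed[OF v(1) a(1)] Comp_closed[OF v(2) a(1)]] by simp
    have "x = b \<cdot> (a \<cdot> x)" if "x \<in> Hom A W X" for x
      using Comp_assoc[OF that a(1) b] ba Ide_Comp[OF that] by simp
    from this[OF v(1)] this[OF v(2)] show "v = v'" by (simp only: av)
  qed
  then show ?thesis using short_exact_kernel[OF f cokernel_is_epi[OF c] k] by simp
qed

text \<open>The pullback \<open>R\<close> formed in \<open>A\<close> is an extension of \<open>Y\<close> by the kernel \<open>K\<close> of \<open>f\<close>, both in the
  heart.  So \<open>R\<close> is in the heart, and the short exact sequence \<open>K \<rightarrow> R \<rightarrow> Y\<close> shows that its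
  projection to \<open>Y\<close> is a cokernel there.\<close>

lemma cokernel_pullback_heart:
  assumes pb: "is_pullback heart p q f g" and c: "is_cokernel heart f h"
  shows "\<exists>h'. is_cokernel heart q h'"
proof -
  interpret H: preadditive_category heart by (rule preadditive_heart)
  define P X Y Z where "P = Dom A p" and "X = Dom A f" and "Y = Dom A g" and "Z = Cod A f"
  have pH: "p \<in> Hom heart P X" and qH: "q \<in> Hom heart P Y" and fH: "f \<in> Hom heart X Z"
    and gH: "g \<in> Hom heart Y Z" and fp: "f \<cdot> p = g \<cdot> q"
    using pb by (auto simp: is_pullback_def Hom_def P_def X_def Y_def Z_def)
  have p: "p \<in> Hom A P X" and q: "q \<in> Hom A P Y" and f: "f \<in> Hom A X Z" and g: "g \<in> Hom A Y Z"
    and Y: "Y \<in> C'" "Y \<in> D" and P: "P \<in> C' \<inter> D" and X: "X \<in> C' \<inter> D"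
    using pH qH fH gH by simp_all
  obtain K k where K: "K \<in> C'" "K \<in> D" and s: "short_exact A K k X f Z"
    using cokernel_heart_short_exact[OF c] by (auto simp: X_def Z_def)
  have k: "k \<in> Hom A K X" "is_kernel A k f" and fe: "is_epi A f"
    using s cokernel_is_epi by (auto simp: short_exact_def)
  obtain R p' q' l where p': "p' \<in> Hom A R X" and pb': "is_pullback A p' q' f g"
    and se: "short_exact A K l R q' Y"
    using ex_pullback_of_epi[OF f fe k g] by auto
  have l: "l \<in> Hom A K R" and q': "q' \<in> Hom A R Y" "is_cokernel A q' l"
    using se by (auto simp: short_exact_def)
  have "R \<in> ext_star A C' C'" "R \<in> ext_star A D D"
    using ext_starI[OF se] K Y by auto
  then have R: "R \<in> C' \<inter> D"
    using torsion_class_extension[OF tp'] torsionfree_class_extension[OF tp] by auto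
  have fp': "f \<cdot> p' = g \<cdot> q'" using pb' by (simp add: is_pullback_def)
  \<comment> \<open>The pullback \<open>R\<close> in \<open>A\<close> lies in the heart, so it is isomorphic to the given one.\<close>
  obtain u where u: "u \<in> Hom A P R" "p' \<cdot> u = p" "q' \<cdot> u = q"
    using pullback_factor[OF pb' p' f g p q fp] .
  have "p' \<in> Hom heart R X" "q' \<in> Hom heart R Y" "f \<cdot>\<^bsub>heart\<^esub> p' = g \<cdot>\<^bsub>heart\<^esub> q'"
    using p' q'(1) R X Y fp' by simp_all
  from H.pullback_factor[OF pb pH fH gH this] obtain v
    where vH: "v \<in> Hom heart R P" and v0: "p \<cdot> v = p'" "q \<cdot> v = q'" by auto
  have v: "v \<in> Hom A R P" using vH by simp
  have vu: "v \<cdot> u = Ide A P"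
  proof (rule H.pullback_cancel[OF pb pH qH, of _ P])
    show "v \<cdot> u \<in> Hom heart P P" "Ide A P \<in> Hom heart P P"
      using Comp_closed[OF u(1) v] Ide_closed[OF Hom_Obj(1)[OF p]] P by simp_all
    show "p \<cdot>\<^bsub>heart\<^esub> (v \<cdot> u) = p \<cdot>\<^bsub>heart\<^esub> Ide A P" "q \<cdot>\<^bsub>heart\<^esub> (v \<cdot> u) = q \<cdot>\<^bsub>heart\<^esub> Ide A P"
      using Comp_assoc[OF u(1) v p] Comp_assoc[OF u(1) v q] v0 u(2,3) Comp_Ide[OF p] Comp_Ide[OF q]
      by simp_all
  qed
  have vl: "v \<cdot> l \<in> Hom A K P" using Comp_closed[OF l v] .
  have "is_cokernel A q (v \<cdot> l)"
  proof (rule is_cokernelI[OF q vl])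
    show "q \<cdot> (v \<cdot> l) = Zero A K Y"
      using Comp_assoc[OF l v q] v0(2) cokernel_Comp[OF q'(2,1) l] by simp
  next
    fix W y assume y: "y \<in> Hom A P W" "y \<cdot> (v \<cdot> l) = Zero A K W"
    have "(y \<cdot> v) \<cdot> l = Zero A K W" using Comp_assoc[OF l v y(1)] y(2) by simp
    then obtain a where a: "a \<in> Hom A Y W" "a \<cdot> q' = y \<cdot> v"
      using cokernel_factor[OF q'(2,1) l Comp_closed[OF v y(1)]] by auto
    have "a \<cdot> q = (y \<cdot> v) \<cdot> u" using Comp_assoc[OF u(1) q'(1) a(1)] u(3) a(2) by simp
    then have "a \<cdot> q = y" using Comp_assoc[OF u(1) v y(1)] vu Comp_Ide[OF y(1)] by simp
    then show "\<exists>v \<in> Hom A Y W. v \<cdot> q = y" by (rule bexI[OF _ a(1)])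
  next
    fix W a a' assume a: "a \<in> Hom A Y W" "a' \<in> Hom A Y W" "a \<cdot> q = a' \<cdot> q"
    have "x \<cdot> q' = (x \<cdot> q) \<cdot> v" if "x \<in> Hom A Y W" for x
      using Comp_assoc[OF v q that] v0(2) by simp
    from this[OF a(1)] this[OF a(2)] have "a \<cdot> q' = a' \<cdot> q'" by (simp only: a(3))
    then show "a = a'" using cokernel_cancel[OF q'(2,1) a(1,2)] by simp
  qed
  moreover have "Cod A q = Y" "Dom A (v \<cdot> l) = K" "Cod A (v \<cdot> l) = P"
    using q vl by (auto simp: Hom_def)
  ultimately have "is_cokernel heart q (v \<cdot> l)"
    using is_cokernel_full_subcat[of A q "v \<cdot> l" "C' \<inter> D"] Y K P by simp
  then show ?thesis by auto
qed

lemma kernel_pushout_heart: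
  assumes "is_pushout heart p q f g" "is_kernel heart f h"
  shows "\<exists>h'. is_kernel heart q h'"
  using torsion_interval.cokernel_pullback_heart[OF opp_interval, of p q f g h, unfolded heart_opp] assms
  by simp

theorem quasi_abelian_heart: "quasi_abelian_category heart"
  by (intro quasi_abelian_category.intro pre_abelian_heart quasi_abelian_category_axioms.intro)
    (erule cokernel_pullback_heart kernel_pushout_heart, assumption)+

section \<open>The correspondence of torsion pairs\<close>

text \<open>For an object of the heart, the decomposition with respect to \<open>(X, Y)\<close> stays in the heart: the
  torsion part is a subobject of an object of \<open>D\<close>, the quotient is one of an object of \<open>C'\<close>.\<close>

lemma torsion_pair_restrict:
  assumes XY: "torsion_pair A X Y" and "C \<subseteq> X" "X \<subseteq> C'"
  shows "torsion_pair heart (X \<inter> D) (Y \<inter> C')"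
proof -
  \<comment> \<open>\<open>(X, Y)\<close> may be taken as the upper end of an interval that starts at \<open>(C, D)\<close>.\<close>
  have "torsion_interval A C D X Y"
    using assms tp abelian_category_axioms by (simp add: torsion_interval_def torsion_interval_axioms_def)
  then have YD: "Y \<subseteq> D" by (rule torsion_interval.D'_le)
  have "\<exists>U \<in> X \<inter> D. \<exists>V \<in> Y \<inter> C'. \<exists>f g. short_exact heart U f M g V" if M: "M \<in> Obj heart" for M
  proof -
    have MO: "M \<in> Obj A" and MC: "M \<in> C'" and MD: "M \<in> D" using M by simp_all
    obtain U V f g where s: "U \<in> X" "V \<in> Y" "short_exact A U f M g V"
      using torsion_pair_short_exact[OF XY MO] .
    have UV: "U \<in> D" "V \<in> C'"
      using s(3) torsionfree_class_subobject[OF tp _ kernel_is_mono MD, of f U g]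
        torsion_class_quotient[OF tp' _ cokernel_is_epi MC, of g V f]
      by (simp_all add: short_exact_def)
    have "U \<in> C' \<inter> D" "M \<in> C' \<inter> D" "V \<in> C' \<inter> D"
      using s(1,2) UV MC MD YD \<open>X \<subseteq> C'\<close> by auto
    from short_exact_full_subcat[OF s(3) this] show ?thesis using s(1,2) UV
      by (intro bexI[of _ U] bexI[of _ V] exI[of _ f] exI[of _ g]) simp_all
  qed
  note ex = this
  have isoX: "iso_closed A X" and isoY: "iso_closed A Y" and Ob: "X \<subseteq> Obj A" "Y \<subseteq> Obj A"
    using XY by (simp_all add: torsion_pair_def)
  have orth: "hom_orthogonal A X Y" using torsion_pair_orthogonal[OF XY] .
  show ?thesis
  proof (rule preadditive_category.torsion_pairI[OF preadditive_heart])
    show "X \<inter> D \<subseteq> Obj heart" "Y \<inter> C' \<subseteq> Obj heart"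
      using Ob YD \<open>X \<subseteq> C'\<close> by auto
    show "iso_closed heart (X \<inter> D)" "iso_closed heart (Y \<inter> C')"
      using iso_closed_full_subcat[OF isoX, of "C' \<inter> D" D]
        iso_closed_full_subcat[OF isoY, of "C' \<inter> D" C'] by simp_all
    show "hom_orthogonal heart (X \<inter> D) (Y \<inter> C')"
      by (rule hom_orthogonalI) (simp add: hom_orthogonalD[OF orth])
  qed (rule ex)
qed

text \<open>The decomposition of an arbitrary object is obtained from
  \<open>A = C' * D' = (C * (T * F)) * D' = ((C * T) * F) * D' = (C * T) * (F * D')\<close>.\<close>

lemma torsion_pair_extend:
  assumes TF: "torsion_pair heart T F"
  shows "torsion_pair A (ext_star A C T) (ext_star A F D')"
    and "C \<subseteq> ext_star A C T" and "ext_star A C T \<subseteq> C'"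
    and "T \<subseteq> ext_star A C T" and "F \<subseteq> ext_star A F D'"
proof -
  have T: "T \<subseteq> C'" "T \<subseteq> D" and F: "F \<subseteq> C'" "F \<subseteq> D"
    using torsion_pair_Obj[OF TF] by auto
  have CD: "hom_orthogonal A C D" and CD': "hom_orthogonal A C' D'"
    using torsion_pair_orthogonal[OF tp] torsion_pair_orthogonal[OF tp'] .
  have "hom_orthogonal A T F"
  proof (rule hom_orthogonalI)
    fix X Y f assume XY: "X \<in> T" "Y \<in> F" and f: "f \<in> Hom A X Y"
    have "f \<in> Hom heart X Y" using f XY T F by auto
    then show "f = Zero A X Y"
      using hom_orthogonalD[OF torsion_pair_orthogonal[OF TF] _ XY] by simp
  qed
  moreover have "hom_orthogonal A C F" by (rule hom_orthogonal_mono[OF CD order_refl F(2)])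
  moreover have "hom_orthogonal A C D'" by (rule hom_orthogonal_mono[OF CD' C_le order_refl])
  moreover have "hom_orthogonal A T D'" by (rule hom_orthogonal_mono[OF CD' T(1) order_refl])
  ultimately have oC: "hom_orthogonal A C (ext_star A F D')"
    and oT: "hom_orthogonal A T (ext_star A F D')" and oF: "hom_orthogonal A (ext_star A C T) F"
    and orth: "hom_orthogonal A (ext_star A C T) (ext_star A F D')"
    by (simp_all add: hom_orthogonal_ext_star hom_orthogonal_ext_star_right)
  have TF_cover: "Obj heart \<subseteq> ext_star A T F"
  proof
    fix M assume "M \<in> Obj heart"
    then obtain X Y f g where s: "X \<in> T" "Y \<in> F" "short_exact heart X f M g Y"
      by (rule torsion_pair_short_exact[OF TF])
    show "M \<in> ext_star A T F" using ext_starI[OF short_exact_heart[OF s(3)] s(1,2)] .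
  qed
  have C'_cover: "C' \<subseteq> ext_star A C (Obj heart)"
  proof
    fix M assume M: "M \<in> C'"
    then have "M \<in> Obj A" using torsion_pair_Obj[OF tp'] by auto
    then obtain X Y f g where s: "X \<in> C" "Y \<in> D" "short_exact A X f M g Y"
      by (rule torsion_pair_short_exact[OF tp])
    have "g \<in> Hom A M Y" "is_cokernel A g f" using s(3) by (simp_all add: short_exact_def)
    then have "Y \<in> C'" using torsion_class_quotient[OF tp' _ cokernel_is_epi M] by simp
    then have "Y \<in> Obj heart" using s(2) short_exact_Obj[OF s(3)] by simp
    then show "M \<in> ext_star A C (Obj heart)" using ext_starI[OF s(3,1)] by simp
  qed
  have "Obj A \<subseteq> ext_star A C' D'"
  proof
    fix M assume "M \<in> Obj A"
    then obtain X Y f g where s: "X \<in> C'" "Y \<in> D'" "short_exact A X f M g Y"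
      by (rule torsion_pair_short_exact[OF tp'])
    show "M \<in> ext_star A C' D'" using ext_starI[OF s(3,1,2)] .
  qed
  also have "\<dots> \<subseteq> ext_star A (ext_star A C (ext_star A T F)) D'"
    using ext_star_mono[OF order_refl TF_cover] C'_cover by (intro ext_star_mono) auto
  also have "\<dots> \<subseteq> ext_star A (ext_star A (ext_star A C T) F) D'"
    by (intro ext_star_mono ext_star_assoc1 order_refl)
  also have "\<dots> \<subseteq> ext_star A (ext_star A C T) (ext_star A F D')"
    by (rule ext_star_assoc2)
  finally have cover: "Obj A \<subseteq> ext_star A (ext_star A C T) (ext_star A F D')" .
  show pair: "torsion_pair A (ext_star A C T) (ext_star A F D')"
  proof (rule torsion_pairI[OF _ _ iso_closed_ext_star iso_closed_ext_star orth])
    show "ext_star A C T \<subseteq> Obj A" "ext_star A F D' \<subseteq> Obj A" by (auto simp: ext_star_def)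
    fix M assume "M \<in> Obj A"
    then have "M \<in> ext_star A (ext_star A C T) (ext_star A F D')" using cover by auto
    then show "\<exists>X \<in> ext_star A C T. \<exists>Y \<in> ext_star A F D'. \<exists>f g. short_exact A X f M g Y"
      unfolding ext_star_def[of A "ext_star A C T"] by simp
  qed
  have torsion: "U \<subseteq> ext_star A C T" if "U \<subseteq> Obj A" "hom_orthogonal A U (ext_star A F D')" for U
  proof
    fix M assume M: "M \<in> U"
    have "hom_orthogonal A {M} (ext_star A F D')"
      using M by (intro hom_orthogonal_mono[OF that(2)]) simp_all
    then show "M \<in> ext_star A C T" using mem_torsion_class[OF pair] M that(1) by auto
  qed
  have TO: "T \<subseteq> Obj A" and FO: "F \<subseteq> Obj A" using torsion_pair_Obj[OF TF] by auto
  show "C \<subseteq> ext_star A C T" using torsion[OF _ oC] torsion_pair_Obj[OF tp] by simp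
  show "T \<subseteq> ext_star A C T" using torsion[OF TO oT] .
  show "F \<subseteq> ext_star A F D'"
  proof
    fix M assume M: "M \<in> F"
    have "hom_orthogonal A (ext_star A C T) {M}"
      using M by (intro hom_orthogonal_mono[OF oF]) simp_all
    then show "M \<in> ext_star A F D'" using mem_torsionfree_class[OF pair] M FO by auto
  qed
  show "ext_star A C T \<subseteq> C'"
    using ext_star_mono[OF C_le T(1)] torsion_class_extension[OF tp'] by (rule order_trans)
qed

text \<open>Both round trips produce a torsion pair that is comparable in each component with the one
  they started from, and comparable torsion pairs agree.\<close>

lemma extend_restrict:
  assumes XY: "torsion_pair A X Y" and CX: "C \<subseteq> X" "X \<subseteq> C'"
  shows "ext_star A C (X \<inter> D) = X \<and> ext_star A (Y \<inter> C') D' = Y"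
proof (rule torsion_pair_eqI[OF torsion_pair_extend(1)[OF torsion_pair_restrict[OF assms]] XY])
  have "torsion_interval A X Y C' D'"
    using assms tp' abelian_category_axioms by (simp add: torsion_interval_def torsion_interval_axioms_def)
  then have D'Y: "D' \<subseteq> Y" by (rule torsion_interval.D'_le)
  show "ext_star A C (X \<inter> D) \<subseteq> X"
    by (rule order_trans[OF ext_star_mono[OF CX(1)] torsion_class_extension[OF XY]]) simp
  show "ext_star A (Y \<inter> C') D' \<subseteq> Y"
    by (rule order_trans[OF ext_star_mono[OF _ D'Y] torsionfree_class_extension[OF XY]]) simp
qed

lemma restrict_extend:
  assumes TF: "torsion_pair heart T F"
  shows "ext_star A C T \<inter> D = T \<and> ext_star A F D' \<inter> C' = F"
proof -
  note ext = torsion_pair_extend[OF TF]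
  have T: "T \<subseteq> D" and F: "F \<subseteq> C'"
    using torsion_pair_Obj[OF TF] by auto
  show ?thesis
    using preadditive_category.torsion_pair_eqI[OF preadditive_heart TF
        torsion_pair_restrict[OF ext(1-3)]] ext(4,5) T F
    by (simp add: eq_commute)
qed

end

theorem theorem1p1:
  fixes A :: "('o, 'm) precat"
    and C D C' D' :: "'o set"
  assumes "abelian_category A"
    and "torsion_pair A C D"
    and "torsion_pair A C' D'"
    and "C \<subseteq> C'"
  shows
    "let H = full_subcat A (C' \<inter> D);
         L = {(X, Y). torsion_pair A X Y \<and> C \<subseteq> X \<and> X \<subseteq> C'};
         R = {(T, F). torsion_pair H T F};
         \<phi> = (\<lambda>(X, Y). (X \<inter> D, Y \<inter> C'));
         \<psi> = (\<lambda>(T, F). (ext_star A C T, ext_star A F D'));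
         le = (\<lambda>p q. fst p \<subseteq> fst q)
     in quasi_abelian_category H \<and>
        bij_betw \<phi> L R \<and> bij_betw \<psi> R L \<and>
        (\<forall>p \<in> L. \<psi> (\<phi> p) = p) \<and> (\<forall>q \<in> R. \<phi> (\<psi> q) = q) \<and>
        monotone_on L le le \<phi> \<and> monotone_on R le le \<psi>"
proof -
  interpret torsion_interval A C D C' D'
    using assms by (simp add: torsion_interval_def torsion_interval_axioms_def)
  define L where "L = {(X, Y). torsion_pair A X Y \<and> C \<subseteq> X \<and> X \<subseteq> C'}"
  define R where "R = {(T, F). torsion_pair heart T F}"
  define \<phi> where "\<phi> = (\<lambda>(X, Y). (X \<inter> D, Y \<inter> C'))"
  define \<psi> where "\<psi> = (\<lambda>(T, F). (ext_star A C T, ext_star A F D'))"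
  define le where "le = (\<lambda>(p :: 'o set \<times> 'o set) (q :: 'o set \<times> 'o set). fst p \<subseteq> fst q)"
  have \<phi>: "\<phi> p \<in> R" and \<psi>\<phi>: "\<psi> (\<phi> p) = p" if "p \<in> L" for p
    using that torsion_pair_restrict extend_restrict by (auto simp: L_def R_def \<phi>_def \<psi>_def)
  have \<psi>: "\<psi> q \<in> L" and \<phi>\<psi>: "\<phi> (\<psi> q) = q" if qR: "q \<in> R" for q
  proof -
    obtain T F where q: "q = (T, F)" and TF: "torsion_pair heart T F"
      using qR by (auto simp: R_def)
    show "\<psi> q \<in> L" using torsion_pair_extend(1-3)[OF TF] by (simp add: L_def \<psi>_def q)
    show "\<phi> (\<psi> q) = q" using restrict_extend[OF TF] by (simp add: \<phi>_def \<psi>_def q)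
  qed
  have "bij_betw \<phi> L R" by (rule bij_betwI[of _ _ _ \<psi>]) (auto intro: \<phi> \<psi> simp: \<psi>\<phi> \<phi>\<psi>)
  moreover have "bij_betw \<psi> R L" by (rule bij_betwI[of _ _ _ \<phi>]) (auto intro: \<phi> \<psi> simp: \<psi>\<phi> \<phi>\<psi>)
  moreover have "monotone_on L le le \<phi>"
    by (auto simp: monotone_on_def le_def \<phi>_def split: prod.splits)
  moreover have "monotone_on R le le \<psi>"
    by (auto simp: monotone_on_def le_def \<psi>_def ext_star_def split: prod.splits)
  ultimately have "quasi_abelian_category heart \<and> bij_betw \<phi> L R \<and> bij_betw \<psi> R L \<and>
      (\<forall>p \<in> L. \<psi> (\<phi> p) = p) \<and> (\<forall>q \<in> R. \<phi> (\<psi> q) = q) \<and>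
      monotone_on L le le \<phi> \<and> monotone_on R le le \<psi>"
    using quasi_abelian_heart \<psi>\<phi> \<phi>\<psi> by simp
  then show ?thesis
    unfolding Let_def L_def R_def \<phi>_def \<psi>_def le_def .
qed

end
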